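(* Let $p$ be prime and $a\in\mathbb{Z}_p^\times$. Then $D(\lambda_a)\le C\,p^{1/2}\log^2 p$ for an absolute constant $C$ (independent of $a$).
   Context: $\lambda_a$ is the permutation of $\mathbb{Z}_p$ defined by $\lambda_a(s)=as^{-1}$ for $s\in\mathbb{Z}_p^\times$ and $\lambda_a(0)=0$. An interval of $\mathbb{Z}_n$ is any subset that is the image of an interval of consecutive integers under the projection $\mathbb{Z}\to\mathbb{Z}_n$ (wrap-around allowed). For $S,T\subseteq\mathbb{Z}_n$, $D_T(S)=\bigl|\,|S\cap T|-|S||T|/n\,\bigr|$, and for a permutation $\sigma$ of $\mathbb{Z}_n$, $D(\sigma)=\max_{I,J}D_J(\sigma(I))$ over all intervals $I,J$ of $\mathbb{Z}_n$. *)

theory Defs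
  imports Complex_Main "HOL-Computational_Algebra.Primes"
begin

text \<open>Z_n is represented by {0..<n} :: nat set.\<close>

definition zinterval :: "nat \<Rightarrow> nat set \<Rightarrow> bool" where
  "zinterval n I \<longleftrightarrow> (\<exists>m::int. \<exists>k::nat. I = (\<lambda>x. nat (x mod int n)) ` {m..<m + int k})"

definition disc :: "nat \<Rightarrow> nat set \<Rightarrow> nat set \<Rightarrow> real" where
  "disc n S T = \<bar>real (card (S \<inter> T)) - real (card S) * real (card T) / real n\<bar>"

definition Dperm :: "nat \<Rightarrow> (nat \<Rightarrow> nat) \<Rightarrow> real" where
  "Dperm n \<sigma> = Max {disc n (\<sigma> ` I) J | I J. zinterval n I \<and> zinterval n J}"

definition zinv :: "nat \<Rightarrow> nat \<Rightarrow> nat" where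
  "zinv p s = (THE t. t < p \<and> (s * t) mod p = 1)"

definition lam :: "nat \<Rightarrow> nat \<Rightarrow> nat \<Rightarrow> nat" where
  "lam p a s = (if s = 0 then 0 else (a * zinv p s) mod p)"

end

theory Submission
  imports "HOL-Algebra.Algebraic_Closure_Type" "Berlekamp_Zassenhaus.Finite_Field"
    "HOL-Analysis.Analysis" Defs
begin

text \<open>By Fourier analysis the discrepancy is controlled by Kloosterman sums, so that the point is the bound
  \<open>2 \<surd>p\<close> of Weil, uniformly in the parameter. For the sums \<open>K\<^sub>n\<close> over the fields with \<open>q = p\<^sup>n\<close> elements,
  counting roots of monic quadratic polynomials gives \<open>K\<^sub>2\<^sub>n = 2q - K\<^sub>n\<^sup>2\<close>. This excludes \<open>\<bar>K\<^sub>1\<bar> > 2 \<surd>p\<close> as soon as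
  \<open>\<bar>K\<^sub>n\<bar> / \<surd>q\<close> is bounded for \<open>n = 2, 4, 8, \<dots>\<close> by a constant that may depend on \<open>p\<close>. Such a bound follows
  from an upper bound \<open>q / p + O(\<surd>q)\<close> for the number of \<open>x\<close> at which \<open>x + a / x\<close> has a given trace, and this
  is shown by an auxiliary polynomial in the manner of Stepanov.\<close>

section \<open>Finite fields and Kloosterman sums\<close>

text \<open>The doubling formula is what survives of the L-function of degree 2: if K_n =
  -(\<alpha>^n + \<beta>^n) with \<alpha> \<beta> = p, it merely expresses \<alpha>^(2n) +
  \<beta>^(2n) through the square of \<alpha>^n + \<beta>^n. Iterating it amplifies any excess over
  2, so a poor constant high up in the tower still yields the sharp one at the bottom. All fields of
  the tower lie in one algebraic closure, where conjugation is a power map and every quadratic has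
  its roots. The logarithms come from the intervals: the Fourier coefficients of each have absolute
  sum O(p log p), and the product of two such sums is weighed by 1/p^2.\<close>

locale char_p_closure =
  fixes p :: nat and ty :: "'c::alg_closed_field itself"
  assumes p_eq: "p = CHAR('c)" and prime_p: "prime p"
begin

text \<open>\<open>F n\<close> is the subfield with \<open>p\<^sup>n\<close> elements and \<open>Tr n\<close> its trace to the prime field \<open>F 1\<close>, on which \<open>psi\<close> is
  an additive character (with a junk value elsewhere).\<close>

definition F :: "nat \<Rightarrow> 'c set" where "F n = {x. x ^ (p ^ n) = x}"

definition Tr :: "nat \<Rightarrow> 'c \<Rightarrow> 'c" where "Tr n x = (\<Sum>i<n. x ^ (p ^ i))"

definition psi :: "'c \<Rightarrow> complex" where
  "psi x = cis (2 * pi * real (SOME k. of_nat k = x) / real p)"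

definition K :: "'c \<Rightarrow> nat \<Rightarrow> complex" where
  "K a n = (\<Sum>x\<in>F n - {0}. psi (Tr n (x + a / x)))"

lemma p_gt_1: "p > 1" and p_pos: "p > 0"
  using prime_gt_1_nat[OF prime_p] by auto

lemma of_nat_p: "of_nat p = (0::'c)"
  by (simp add: p_eq)

lemma q_pos: "p ^ n > 0"
  using p_pos by simp

lemma q_gt_1: "n > 0 \<Longrightarrow> p ^ n > 1"
  by (rule one_less_power[OF p_gt_1])

section \<open>Powers of Frobenius and the subfields they fix\<close>

lemma frob_add: "(x + y :: 'c) ^ (p ^ n) = x ^ (p ^ n) + y ^ (p ^ n)"
  by (rule freshmans_dream') (use prime_p p_eq in auto)

lemma frob_sum: "(sum f A :: 'c) ^ (p ^ n) = (\<Sum>i\<in>A. f i ^ (p ^ n))"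
  by (rule freshmans_dream_sum') (use prime_p p_eq in auto)

lemma frob_diff: "(x - y :: 'c) ^ (p ^ n) = x ^ (p ^ n) - y ^ (p ^ n)"
  using frob_add[of "x - y" y n] by (simp add: algebra_simps)

lemma frob_frob: "(x ^ (p ^ m)) ^ (p ^ n) = (x::'c) ^ (p ^ (m + n))"
  by (simp add: power_add power_mult)

lemma F_add: "x \<in> F n \<Longrightarrow> y \<in> F n \<Longrightarrow> x + y \<in> F n"
  and F_diff: "x \<in> F n \<Longrightarrow> y \<in> F n \<Longrightarrow> x - y \<in> F n"
  and F_mult: "x \<in> F n \<Longrightarrow> y \<in> F n \<Longrightarrow> x * y \<in> F n"
  and F_divide: "x \<in> F n \<Longrightarrow> y \<in> F n \<Longrightarrow> x / y \<in> F n"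
  and F_0: "0 \<in> F n" and F_1: "1 \<in> F n"
  using p_pos
  by (auto simp: F_def frob_add frob_diff power_mult_distrib power_divide power_0_left)

lemma F_uminus: "x \<in> F n \<Longrightarrow> - x \<in> F n"
  using F_diff[OF F_0, of x n] by simp

lemma F_of_nat: "of_nat k \<in> F n"
  by (induction k) (auto simp: F_0 F_1 F_add)

lemma F_double: "F n \<subseteq> F (2 * n)"
  by (auto simp: F_def power_add power_mult mult_2)

lemma F_1_subset: "F 1 \<subseteq> F n"
proof
  fix x :: 'c assume "x \<in> F 1"
  hence "x ^ p = x" by (simp add: F_def)
  hence "x ^ (p ^ n) = x" by (induction n) (simp_all add: power_mult)
  thus "x \<in> F n" by (simp add: F_def)
qed

text \<open>The derivative of X^q - X is -1 in characteristic p, so there are no repeated roots;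
  since the polynomial splits, its q roots are distinct.\<close>

lemma card_F:
  assumes "n > 0"
  shows "finite (F n)" "card (F n) = p ^ n"
proof -
  define P :: "'c poly" where "P = Polynomial.monom 1 (p ^ n) - Polynomial.monom 1 1"
  have q: "p ^ n > 1" using q_gt_1 assms .
  have lead: "poly.coeff P (p ^ n) = 1" using q by (simp add: P_def)
  have deg: "Polynomial.degree P = p ^ n"
  proof (rule antisym)
    show "Polynomial.degree P \<le> p ^ n"
      unfolding P_def using q by (intro degree_diff_le) (auto intro: order.trans[OF degree_monom_le])
    show "p ^ n \<le> Polynomial.degree P" using lead by (intro le_degree) auto
  qed
  have P0: "P \<noteq> 0" using lead by auto
  have roots: "{x. poly P x = 0} = F n"
    by (auto simp: P_def F_def poly_monom)
  have pd: "poly (pderiv P) x = -1" for x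
    using of_nat_p assms by (simp add: P_def pderiv_diff pderiv_monom poly_monom)
  show fin: "finite (F n)"
    using poly_roots_finite[OF P0] roots by simp
  have le: "card (F n) \<le> p ^ n"
    using card_poly_roots_bound[OF P0] roots deg by simp
  obtain A where A: "size A = p ^ n" "P = (\<Prod>x\<in>#A. [:-x, 1:])"
    using alg_closed_imp_factorization[OF P0] deg lead by auto
  have cnt: "count A c = 1" if "c \<in># A" for c
  proof (rule ccontr)
    assume "count A c \<noteq> 1"
    moreover have "count A c > 0" using that by simp
    ultimately have "count A c \<ge> Suc (Suc 0)" by linarith
    hence "{#c, c#} \<subseteq># A"
      by (intro mset_subset_eqI) auto
    then obtain B where "A = {#c, c#} + B"
      using subset_mset.le_iff_add by blast
    hence "P = [:-c, 1:] * ([:-c, 1:] * (\<Prod>x\<in>#B. [:-x, 1:]))"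
      by (simp add: A(2))
    hence "poly (pderiv P) c = 0"
      by (simp only: pderiv_mult) simp
    with pd show False by simp
  qed
  have "card (set_mset A) = size A"
    using cnt by (simp add: size_multiset_overloaded_eq)
  moreover have "set_mset A \<subseteq> F n"
    unfolding roots[symmetric] by (auto simp: A(2) poly_prod_mset prod_mset_zero_iff)
  ultimately have "p ^ n \<le> card (F n)"
    using A(1) card_mono[OF fin] by metis
  with le show "card (F n) = p ^ n" by simp
qed

section \<open>The prime field and its additive character\<close>

lemma inj_on_of_nat: "inj_on (of_nat :: nat \<Rightarrow> 'c) {..<p}"
  by (rule inj_onI) (auto simp: of_nat_eq_iff_cong_CHAR p_eq dest: cong_less_modulus_unique_nat)

lemma F_1_eq: "F (Suc 0) = of_nat ` {..<p}"
proof (rule sym, rule card_subset_eq)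
  show "finite (F (Suc 0))" using card_F by simp
  show "of_nat ` {..<p} \<subseteq> F (Suc 0)" using F_of_nat by auto
  show "card (of_nat ` {..<p} :: 'c set) = card (F (Suc 0))"
    using card_F[of 1] by (simp add: card_image inj_on_of_nat)
qed

text \<open>Representatives of one element differ by a multiple of p, which changes the angle by
  full turns; the choice made by \<open>SOME\<close> does not matter.\<close>

lemma psi_of_nat: "psi (of_nat k) = cis (2 * pi * real k / real p)"
proof -
  define j where "j = (SOME j. of_nat j = (of_nat k :: 'c))"
  have "of_nat j = (of_nat k :: 'c)" unfolding j_def by (rule someI[of _ k]) simp
  hence "[j = k] (mod p)" by (simp add: of_nat_eq_iff_cong_CHAR p_eq)
  then obtain u v where "j + p * u = k + p * v"
    by (metis cong_iff_lin_nat mult.commute)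
  hence "real j + real p * real u = real k + real p * real v"
    by (metis of_nat_add of_nat_mult)
  hence "real j = real k + real p * (real v - real u)"
    by (simp add: algebra_simps)
  hence "real j / real p = real k / real p + of_int (int v - int u)"
    using p_pos by (simp add: add_divide_distrib)
  hence "2 * pi * (real j / real p) = 2 * pi * (real k / real p) + 2 * pi * of_int (int v - int u)"
    by (simp add: ring_distribs)
  hence "2 * pi * real j / real p = 2 * pi * real k / real p + 2 * pi * of_int (int v - int u)"
    by simp
  hence "cis (2 * pi * real j / real p) = cis (2 * pi * real k / real p) * cis (2 * pi * of_int (int v - int u))"
    by (simp only: cis_mult)
  also have "cis (2 * pi * of_int (int v - int u)) = 1"
    by (rule cis_multiple_2pi) simp
  finally show ?thesis by (simp add: psi_def j_def)
qed

lemma psi_0: "psi 0 = 1"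
  using psi_of_nat[of 0] by simp

lemma psi_add:
  assumes "x \<in> F 1" "y \<in> F 1"
  shows "psi (x + y) = psi x * psi y"
proof -
  obtain j k where jk: "x = of_nat j" "y = of_nat k" using assms by (auto simp: F_1_eq)
  have "psi (x + y) = psi (of_nat (j + k))" by (simp add: jk)
  also have "\<dots> = psi x * psi y"
    unfolding jk psi_of_nat by (simp add: cis_mult ring_distribs add_divide_distrib)
  finally show ?thesis .
qed

lemma norm_psi: "norm (psi x) = 1"
  by (simp add: psi_def)

lemma psi_neq_1:
  assumes "x \<in> F 1" "x \<noteq> 0"
  shows "psi x \<noteq> 1"
proof
  assume 1: "psi x = 1"
  obtain k where k: "k < p" "x = of_nat k" using assms by (auto simp: F_1_eq)
  have "k > 0" using k assms by (cases k) auto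
  have "cis (2 * pi * real k / real p) = 1" using 1 k by (simp add: psi_of_nat)
  hence "cos (2 * pi * real k / real p) = 1" by (metis cis.simps(1) one_complex.simps(1))
  then obtain m :: int where "2 * pi * real k / real p = of_int m * 2 * pi"
    by (auto simp: cos_one_2pi_int)
  hence "real k = of_int m * real p" using p_pos by (simp add: field_simps)
  hence "int k = m * int p" by (metis of_int_eq_iff of_int_mult of_int_of_nat_eq)
  hence "p dvd k" by (metis dvd_triv_right int_dvd_int_iff)
  with k \<open>k > 0\<close> show False by (auto dest: dvd_imp_le)
qed

section \<open>The trace and orthogonality\<close>

lemma Tr_add: "Tr n (x + y) = Tr n x + Tr n y"
  by (simp add: Tr_def frob_add sum.distrib)

text \<open>Frobenius moves each summand to the next one, and the last to x^(p^n) = x.\<close>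

lemma Tr_in_F_1:
  assumes "x \<in> F n"
  shows "Tr n x \<in> F 1"
proof -
  have "Tr n x ^ p = (\<Sum>i<n. x ^ (p ^ Suc i))"
    using frob_sum[of "\<lambda>i. x ^ (p ^ i)" "{..<n}" 1]
    by (simp add: Tr_def mult.commute flip: power_mult)
  also have "\<dots> = (\<Sum>i<Suc n. x ^ (p ^ i)) - x"
    by (subst sum.lessThan_Suc_shift) simp
  also have "\<dots> = Tr n x"
    using assms by (simp add: Tr_def F_def)
  finally show ?thesis by (simp add: F_def)
qed

lemma Tr_double: "Tr (2 * n) x = Tr n (x + x ^ (p ^ n))"
proof -
  have "Tr (2 * n) x = Tr n x + (\<Sum>i\<in>{0 + n..<n + n}. x ^ (p ^ i))"
    using sum.atLeastLessThan_concat[of 0 n "n + n" "\<lambda>i. x ^ (p ^ i)"]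
    by (simp add: Tr_def atLeast0LessThan mult_2)
  also have "(\<Sum>i\<in>{0 + n..<n + n}. x ^ (p ^ i)) = Tr n (x ^ (p ^ n))"
    by (subst sum.shift_bounds_nat_ivl) (simp add: Tr_def atLeast0LessThan frob_frob add.commute)
  finally show ?thesis by (simp add: Tr_add)
qed

text \<open>The trace is a nonzero polynomial of degree at most p^(n-1), too small to vanish at all
  p^n elements of \<open>F n\<close>.\<close>

lemma Tr_surj:
  assumes "n > 0"
  obtains y where "y \<in> F n" "Tr n y \<noteq> 0"
proof -
  define P :: "'c poly" where "P = (\<Sum>i<n. Polynomial.monom 1 (p ^ i))"
  have "poly.coeff P 1 = (\<Sum>i<n. if i = 0 then 1 else 0)"
    unfolding P_def coeff_sum using p_gt_1 by (intro sum.cong) auto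
  hence "poly.coeff P 1 = 1" using assms by simp
  hence P0: "P \<noteq> 0" by auto
  have "Polynomial.degree P \<le> p ^ (n - 1)"
    unfolding P_def
    by (rule degree_sum_le) (use p_gt_1 in \<open>auto intro!: order.trans[OF degree_monom_le] power_increasing\<close>)
  also have "\<dots> < p ^ n" using assms p_gt_1 by (intro power_strict_increasing) auto
  finally have deg: "Polynomial.degree P < p ^ n" .
  have "card {x. poly P x = 0} < card (F n)"
    using card_poly_roots_bound[OF P0] deg card_F(2)[OF assms] by simp
  hence "\<not> F n \<subseteq> {x. poly P x = 0}"
    using card_mono[OF poly_roots_finite[OF P0]] by (meson leD)
  then obtain y where "y \<in> F n" "poly P y \<noteq> 0" by blast
  thus ?thesis
    by (intro that[of y]) (auto simp: P_def Tr_def poly_sum poly_monom)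
qed

text \<open>Translating y by some z for which c * z has nonzero trace multiplies the sum by a value
  of \<open>psi\<close> other than 1.\<close>

lemma sum_psi_Tr_0:
  assumes "n > 0" "c \<in> F n" "c \<noteq> 0"
  shows "(\<Sum>y\<in>F n. psi (Tr n (c * y))) = 0"
proof -
  obtain y where y: "y \<in> F n" "Tr n y \<noteq> 0" using Tr_surj assms(1) .
  define z where "z = y / c"
  have z: "z \<in> F n" "c * z = y" using y assms by (auto simp: z_def F_divide)
  let ?S = "\<Sum>y\<in>F n. psi (Tr n (c * y))"
  have "?S = (\<Sum>y\<in>F n. psi (Tr n (c * (z + y))))"
    by (rule sum.reindex_bij_witness[of _ "\<lambda>y. z + y" "\<lambda>y. y - z"])
       (use z in \<open>auto intro: F_add F_diff\<close>)
  also have "\<dots> = (\<Sum>y\<in>F n. psi (Tr n (c * z)) * psi (Tr n (c * y)))"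
    by (intro sum.cong refl)
       (use z assms in \<open>auto simp: ring_distribs Tr_add intro!: psi_add Tr_in_F_1 F_mult\<close>)
  also have "\<dots> = psi (Tr n y) * ?S" by (simp add: sum_distrib_left z)
  finally have "(1 - psi (Tr n y)) * ?S = 0" by (simp add: algebra_simps)
  moreover have "psi (Tr n y) \<noteq> 1" using y by (intro psi_neq_1 Tr_in_F_1)
  ultimately show ?thesis by simp
qed

subsection \<open>Quadratic extensions\<close>

text \<open>The two kinds of monic quadratic polynomials over \<open>F n\<close>: those with an ordered pair of roots in
  \<open>F n\<close>, and those with a root in the quadratic extension \<open>F (2 * n)\<close> whose conjugate is the other root.
  A repeated root is counted once on each side.\<close>

lemma quadratic_fibres:
  assumes s: "s \<in> F n" and t: "t \<in> F n" "t \<noteq> 0"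
  shows "card {xy \<in> (F n - {0}) \<times> (F n - {0}). (fst xy + snd xy, fst xy * snd xy) = (s, t)} +
         card {x \<in> F (2 * n) - {0}. (x + x ^ (p ^ n), x * x ^ (p ^ n)) = (s, t)} = 2"
    (is "card ?P + card ?E = 2")
proof -
  let ?q = "p ^ n"
  obtain u where "poly [:t, - s, 1:] u = 0"
    using alg_closed_imp_poly_has_root[of "[:t, - s, 1:]"] by auto
  hence ut: "t = u * (s - u)" by (simp add: algebra_simps)
  define v where "v = s - u"
  have uv: "u + v = s" "u * v = t" by (simp_all add: v_def ut)
  have vu: "v + u = s" "v * u = t" using uv by (simp_all add: add.commute mult.commute)
  have su: "s - u = v" "s - v = u" using uv vu by (metis add_diff_cancel_left')+
  have roots: "x = u \<or> x = v" if "x * (s - x) = t" for x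
  proof -
    have "(x - u) * (x - v) = u * v - x * (u + v - x)" by (simp add: algebra_simps)
    also have "\<dots> = 0" unfolding uv that by simp
    finally show ?thesis by simp
  qed
  have nz: "u \<noteq> 0" "v \<noteq> 0" using uv t by auto
  \<comment> \<open>The power map fixes the coefficients s and t, so it sends the root u to u or to
    v.\<close>
  have "u ^ ?q * (s - u ^ ?q) = t"
  proof -
    have "t ^ ?q = (u * (s - u)) ^ ?q" by (simp only: ut)
    also have "\<dots> = u ^ ?q * (s ^ ?q - u ^ ?q)"
      by (simp only: power_mult_distrib frob_diff)
    finally show ?thesis using s t(1) by (simp only: F_def mem_Collect_eq)
  qed
  hence "u ^ ?q = u \<or> u ^ ?q = v" by (rule roots)
  thus ?thesis
  proof
    assume "u ^ ?q = u"
    hence u: "u \<in> F n" by (simp add: F_def)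
    hence v: "v \<in> F n" using s by (simp add: v_def F_diff)
    have P: "?P = {(u, v), (v, u)}"
    proof (intro equalityI subsetI)
      fix z assume "z \<in> ?P"
      then obtain x y where z: "z = (x, y)" "x + y = s" "x * y = t" by (cases z) auto
      hence y: "y = s - x" by (metis add_diff_cancel_left')
      hence "x = u \<or> x = v" using z by (intro roots) auto
      thus "z \<in> {(u, v), (v, u)}" using y z su by auto
    qed (use u v uv vu nz in auto)
    \<comment> \<open>An element of \<open>F n\<close> is its own conjugate, so it occurs here only
      as a double root.\<close>
    have E: "?E = (if u = v then {u} else {})"
    proof (intro equalityI subsetI)
      fix x assume "x \<in> ?E"
      hence x: "x + x ^ ?q = s" "x * x ^ ?q = t" by auto
      hence xq: "x ^ ?q = s - x" by (metis add_diff_cancel_left')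
      hence "x = u \<or> x = v" using x by (intro roots) auto
      moreover from this have "x ^ ?q = x" using u v by (auto simp: F_def)
      ultimately show "x \<in> (if u = v then {u} else {})"
        using xq su by auto
    next
      fix x assume "x \<in> (if u = v then {u} else {})"
      thus "x \<in> ?E" using u uv nz F_double[of n] by (auto simp: F_def split: if_splits)
    qed
    show ?thesis unfolding P E by (cases "u = v") auto
  next
    assume uq: "u ^ ?q = v"
    show ?thesis
    proof (cases "u = v")
      case False
      have vq: "v ^ ?q = u" using s uq by (simp add: v_def frob_diff F_def)
      have P: "?P = {}"
      proof (intro equals0I)
        fix z assume "z \<in> ?P"
        then obtain x y where z: "x + y = s" "x * y = t" "x \<in> F n" by (cases z) auto
        hence "y = s - x" by (metis add_diff_cancel_left')
        hence "x = u \<or> x = v" using z by (intro roots) auto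
        thus False using z uq vq False by (auto simp: F_def)
      qed
      have E: "?E = {u, v}"
      proof (intro equalityI subsetI)
        fix x assume "x \<in> ?E"
        hence x: "x + x ^ ?q = s" "x * x ^ ?q = t" by auto
        hence xq: "x ^ ?q = s - x" by (metis add_diff_cancel_left')
        hence "x = u \<or> x = v" using x by (intro roots) auto
        thus "x \<in> {u, v}" by simp
      next
        fix x assume "x \<in> {u, v}"
        moreover have "u \<in> F (2 * n)" "v \<in> F (2 * n)"
          using uq vq by (simp_all add: F_def mult_2 frob_frob[symmetric])
        ultimately show "x \<in> ?E" using uq vq uv vu nz by auto
      qed
      show ?thesis unfolding P E using False by simp
    next
      case True
      hence u: "u \<in> F n" using uq by (simp add: F_def)
      have P: "?P = {(u, u)}"
      proof (intro equalityI subsetI)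
        fix z assume "z \<in> ?P"
        then obtain x y where z: "z = (x, y)" "x + y = s" "x * y = t" by (cases z) auto
        hence y: "y = s - x" by (metis add_diff_cancel_left')
        hence "x = u \<or> x = v" using z by (intro roots) auto
        thus "z \<in> {(u, u)}" using y z su True by auto
      qed (use u uv nz True in auto)
      have E: "?E = {u}"
      proof (intro equalityI subsetI)
        fix x assume "x \<in> ?E"
        hence x: "x + x ^ ?q = s" "x * x ^ ?q = t" by auto
        hence xq: "x ^ ?q = s - x" by (metis add_diff_cancel_left')
        hence "x = u \<or> x = v" using x by (intro roots) auto
        thus "x \<in> {u}" using True by auto
      qed (use u uv uq nz F_double[of n] True in auto)
      show ?thesis unfolding P E by simp
    qed
  qed
qed

text \<open>With \<open>s\<close> and \<open>t\<close> the sum and the product of the two elements involved, the terms of both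
  \<open>(K a n)\<^sup>2\<close> and \<open>K a (2 * n)\<close> are \<open>psi (Tr n (s * (1 + a / t)))\<close>; by \<open>quadratic_fibres\<close> every pair \<open>(s, t)\<close>
  occurs exactly twice in total.\<close>

lemma K_double:
  assumes n: "n > 0" and a: "a \<in> F 1" "a \<noteq> 0"
  shows "K a (2 * n) = 2 * of_nat (p ^ n) - (K a n)\<^sup>2"
proof -
  let ?q = "p ^ n"
  define g where "g = (\<lambda>(s, t). psi (Tr n (s * (1 + a / t))))"
  define P0 where "P0 = (F n - {0}) \<times> (F n - {0})"
  define E0 where "E0 = F (2 * n) - {0}"
  define B where "B = F n \<times> (F n - {0})"
  define f where "f = (\<lambda>xy :: 'c \<times> 'c. (fst xy + snd xy, fst xy * snd xy))"
  define h where "h = (\<lambda>x :: 'c. (x + x ^ ?q, x * x ^ ?q))"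
  have fin: "finite (F n)" "finite (F (2 * n))" using card_F n by auto
  have fins: "finite P0" "finite E0" "finite B" using fin by (auto simp: P0_def E0_def B_def)
  have an: "a \<in> F n" using a F_1_subset by blast
  have aq: "a ^ ?q = a" using an by (simp add: F_def)
  have fB: "f ` P0 \<subseteq> B" by (auto simp: f_def P0_def B_def F_add F_mult)
  have hB: "h ` E0 \<subseteq> B"
  proof safe
    fix s t x assume x: "x \<in> E0" and st: "(s, t) = h x"
    have "(x ^ ?q) ^ ?q = x"
      using x by (simp add: E0_def F_def frob_frob mult_2)
    thus "(s, t) \<in> B" using x st
      by (auto simp: B_def h_def E0_def F_def frob_add power_mult_distrib algebra_simps)
  qed
  have "(K a n)\<^sup>2 = (\<Sum>xy\<in>P0. psi (Tr n (fst xy + a / fst xy)) * psi (Tr n (snd xy + a / snd xy)))"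
    by (simp add: K_def power2_eq_square sum_product sum.cartesian_product P0_def case_prod_unfold)
  also have "\<dots> = (\<Sum>xy\<in>P0. g (f xy))"
  proof (intro sum.cong refl)
    fix xy assume xy: "xy \<in> P0"
    obtain x y where [simp]: "xy = (x, y)" by (cases xy)
    have xy': "x \<in> F n" "y \<in> F n" "x \<noteq> 0" "y \<noteq> 0" using xy by (auto simp: P0_def)
    have "psi (Tr n (x + a / x)) * psi (Tr n (y + a / y)) = psi (Tr n (x + a / x) + Tr n (y + a / y))"
      using xy' an by (intro psi_add[symmetric] Tr_in_F_1 F_add F_divide)
    also have "Tr n (x + a / x) + Tr n (y + a / y) = Tr n ((x + y) * (1 + a / (x * y)))"
      unfolding Tr_add[symmetric] using xy' by (intro arg_cong[of _ _ "Tr n"]) (simp add: field_simps)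
    finally show "psi (Tr n (fst xy + a / fst xy)) * psi (Tr n (snd xy + a / snd xy)) = g (f xy)"
      by (simp add: g_def f_def)
  qed
  also have "\<dots> = (\<Sum>b\<in>B. \<Sum>xy\<in>{xy \<in> P0. f xy = b}. g (f xy))"
    by (rule sum.group[symmetric]) (use fins fB in auto)
  also have "\<dots> = (\<Sum>b\<in>B. of_nat (card {xy \<in> P0. f xy = b}) * g b)"
    by (intro sum.cong) auto
  finally have 1: "(K a n)\<^sup>2 = (\<Sum>b\<in>B. of_nat (card {xy \<in> P0. f xy = b}) * g b)" .
  have "K a (2 * n) = (\<Sum>x\<in>E0. g (h x))"
    unfolding K_def E0_def[symmetric]
  proof (intro sum.cong refl)
    fix x assume x: "x \<in> E0"
    hence "x \<noteq> 0" by (simp add: E0_def)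
    hence "x + a / x + (x + a / x) ^ ?q = (x + x ^ ?q) * (1 + a / (x * x ^ ?q))"
      by (simp add: frob_add power_divide aq field_simps)
    thus "psi (Tr (2 * n) (x + a / x)) = g (h x)"
      by (simp add: g_def h_def Tr_double)
  qed
  also have "\<dots> = (\<Sum>b\<in>B. \<Sum>x\<in>{x \<in> E0. h x = b}. g (h x))"
    by (rule sum.group[symmetric]) (use fins hB in auto)
  also have "\<dots> = (\<Sum>b\<in>B. of_nat (card {x \<in> E0. h x = b}) * g b)"
    by (intro sum.cong) auto
  finally have "K a (2 * n) = (\<Sum>b\<in>B. of_nat (card {x \<in> E0. h x = b}) * g b)" .
  with 1 have "(K a n)\<^sup>2 + K a (2 * n) =
      (\<Sum>b\<in>B. of_nat (card {xy \<in> P0. f xy = b} + card {x \<in> E0. h x = b}) * g b)"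
    by (simp add: sum.distrib ring_distribs)
  also have "\<dots> = (\<Sum>b\<in>B. 2 * g b)"
  proof (intro sum.cong refl)
    fix b assume b: "b \<in> B"
    obtain s t where st: "b = (s, t)" by (cases b)
    have "card {xy \<in> P0. f xy = b} + card {x \<in> E0. h x = b} = 2"
      unfolding st P0_def E0_def f_def h_def
      by (rule quadratic_fibres) (use b st in \<open>auto simp: B_def\<close>)
    thus "of_nat (card {xy \<in> P0. f xy = b} + card {x \<in> E0. h x = b}) * g b = 2 * g b"
      by simp
  qed
  also have "\<dots> = 2 * (\<Sum>b\<in>B. g b)" by (simp add: sum_distrib_left)
  also have "(\<Sum>b\<in>B. g b) = (\<Sum>t\<in>F n - {0}. \<Sum>s\<in>F n. psi (Tr n ((1 + a / t) * s)))"
    unfolding B_def g_def sum.cartesian_product[symmetric]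
    by (subst sum.swap) (simp add: mult.commute)
  \<comment> \<open>The sum over s cancels unless 1 + a / t = 0; the single exception t = -a
    produces the main term.\<close>
  also have "\<dots> = (\<Sum>t\<in>F n - {0}. if t = - a then of_nat ?q else 0)"
  proof (intro sum.cong refl)
    fix t assume t: "t \<in> F n - {0}"
    show "(\<Sum>s\<in>F n. psi (Tr n ((1 + a / t) * s))) = (if t = - a then of_nat ?q else 0)"
    proof (cases "t = - a")
      case True
      hence "1 + a / t = 0" using a by simp
      thus ?thesis using True card_F[OF n] p_pos by (simp add: Tr_def psi_0 power_0_left)
    next
      case False
      hence "1 + a / t \<noteq> 0" using t by (auto simp: field_simps eq_neg_iff_add_eq_0)
      moreover have "1 + a / t \<in> F n" using t an by (auto intro: F_add F_1 F_divide)
      ultimately show ?thesis using False n by (simp add: sum_psi_Tr_0)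
    qed
  qed
  also have "\<dots> = of_nat ?q" using fin an a by (simp add: F_uminus)
  finally show ?thesis by (simp add: algebra_simps)
qed

end

subsection \<open>The number of elements of given trace\<close>

lemma sum_distinct_degrees_neq_0:
  fixes f :: "'i \<Rightarrow> 'a::comm_ring_1 poly"
  assumes "finite T" "T \<noteq> {}" and nz: "\<And>t. t \<in> T \<Longrightarrow> f t \<noteq> 0"
    and inj: "inj_on (\<lambda>t. Polynomial.degree (f t)) T"
  shows "sum f T \<noteq> 0"
proof -
  define d where "d = Max ((\<lambda>t. Polynomial.degree (f t)) ` T)"
  have "d \<in> (\<lambda>t. Polynomial.degree (f t)) ` T" unfolding d_def using assms by (intro Max_in) auto
  then obtain t where t: "t \<in> T" "Polynomial.degree (f t) = d" by auto
  have "poly.coeff (f u) d = 0" if u: "u \<in> T - {t}" for u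
  proof (rule coeff_eq_0)
    have "Polynomial.degree (f u) \<le> d" unfolding d_def using assms u by (intro Max_ge) auto
    moreover have "Polynomial.degree (f u) \<noteq> d" using inj_onD[OF inj] u t by (metis Diff_iff singletonI)
    ultimately show "Polynomial.degree (f u) < d" by simp
  qed
  hence "poly.coeff (sum f T) d = poly.coeff (f t) d"
    using t assms(1) by (simp add: coeff_sum sum.remove[of T t])
  also have "\<dots> \<noteq> 0" using nz t leading_coeff_neq_0 by metis
  finally show ?thesis by auto
qed

context char_p_closure
begin

text \<open>A finite coefficient field allows counting by pigeonhole. Stepanov's construction stays
  within it because a and \<theta> lie in \<open>F 1\<close>.\<close>

definition PF :: "'c poly set" where "PF = {P. \<forall>i. poly.coeff P i \<in> F 1}"

lemma F_sum: "(\<And>i. i \<in> A \<Longrightarrow> f i \<in> F n) \<Longrightarrow> sum f A \<in> F n"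
  by (induction A rule: infinite_finite_induct) (auto simp: F_0 F_add)

lemma PF_diff: "P \<in> PF \<Longrightarrow> R \<in> PF \<Longrightarrow> P - R \<in> PF"
  and PF_add: "P \<in> PF \<Longrightarrow> R \<in> PF \<Longrightarrow> P + R \<in> PF"
  and PF_monom: "c \<in> F 1 \<Longrightarrow> Polynomial.monom c k \<in> PF"
  by (auto simp: PF_def F_add F_diff F_0)

lemma PF_mult: "P \<in> PF \<Longrightarrow> R \<in> PF \<Longrightarrow> P * R \<in> PF"
  by (auto simp: PF_def coeff_mult simp del: One_nat_def intro!: F_sum F_mult)

lemma PF_power: "P \<in> PF \<Longrightarrow> P ^ k \<in> PF"
proof (induction k)
  case 0
  show ?case using PF_monom[OF F_1, of 0] by (simp add: one_poly_eq_simps)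
qed (auto intro: PF_mult)

lemma PF_sum: "(\<And>i. i \<in> A \<Longrightarrow> f i \<in> PF) \<Longrightarrow> sum f A \<in> PF"
  by (auto simp: PF_def coeff_sum simp del: One_nat_def intro!: F_sum)

text \<open>The pigeonhole principle replaces linear algebra: there are more coefficient vectors than polynomials
  of degree at most \<open>D\<close> over the prime field.\<close>

lemma linear_dependence_over_F_1:
  fixes f :: "'i \<Rightarrow> 'c poly"
  assumes S: "finite S" "card S > Suc D"
    and f: "\<And>s. s \<in> S \<Longrightarrow> f s \<in> PF" "\<And>s. s \<in> S \<Longrightarrow> Polynomial.degree (f s) \<le> D"
  obtains c where "\<And>s. c s \<in> F 1" "\<exists>s\<in>S. c s \<noteq> 0" "(\<Sum>s\<in>S. smult (c s) (f s)) = 0"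
proof -
  let ?C = "S \<rightarrow>\<^sub>E F 1"
  let ?L = "\<lambda>c. \<Sum>s\<in>S. smult (c s) (f s)"
  let ?v = "\<lambda>c. restrict (poly.coeff (?L c)) {..D}"
  have fin1: "finite (F 1)" "card (F 1) = p" using card_F[of 1] by auto
  have "?v ` ?C \<subseteq> {..D} \<rightarrow>\<^sub>E F 1"
  proof (rule image_subsetI)
    fix c assume c: "c \<in> ?C"
    have "smult (c s) (f s) \<in> PF" if "s \<in> S" for s
      using c f(1)[OF that] that by (auto simp: PF_def simp del: One_nat_def intro!: F_mult)
    hence "?L c \<in> PF" by (rule PF_sum)
    thus "?v c \<in> {..D} \<rightarrow>\<^sub>E F 1" by (auto simp: PF_def)
  qed
  hence "card (?v ` ?C) \<le> card ({..D} \<rightarrow>\<^sub>E F 1)"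
    using fin1 by (intro card_mono finite_PiE) auto
  also have "\<dots> = p ^ Suc D" using fin1 by (simp add: card_funcsetE)
  also have "\<dots> < p ^ card S" using S p_gt_1 by (intro power_strict_increasing) auto
  also have "\<dots> = card ?C" using fin1 S by (simp add: card_funcsetE)
  finally have "\<not> inj_on ?v ?C" by (rule pigeonhole)
  then obtain c1 c2 where c: "c1 \<in> ?C" "c2 \<in> ?C" "c1 \<noteq> c2" "?v c1 = ?v c2"
    by (auto simp: inj_on_def)
  define c where "c = (\<lambda>s. if s \<in> S then c1 s - c2 s else 0)"
  show thesis
  proof
    show "c s \<in> F 1" for s using c by (auto simp: c_def F_0 simp del: One_nat_def intro!: F_diff)
    have "\<exists>s. c1 s \<noteq> c2 s" using c(3) by auto
    thus "\<exists>s\<in>S. c s \<noteq> 0" using c(1,2) by (force simp: c_def PiE_iff extensional_def)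
    have deg: "Polynomial.degree (?L b) \<le> D" for b
      using S(1) f(2) by (intro degree_sum_le order.trans[OF degree_smult_le]) auto
    have "poly.coeff (?L c1) i = poly.coeff (?L c2) i" for i
    proof (cases "i \<le> D")
      case True
      thus ?thesis using fun_cong[OF c(4), of i] by simp
    next
      case False
      thus ?thesis using deg[of c1] deg[of c2] by (simp only: coeff_eq_0)
    qed
    hence "?L c1 = ?L c2" by (rule poly_eqI)
    moreover have "?L c = ?L c1 - ?L c2"
      unfolding sum_subtractf[symmetric] by (intro sum.cong) (auto simp: c_def smult_diff_left)
    ultimately show "?L c = 0" by simp
  qed
qed

text \<open>Stepanov's method with \<open>Q = p\<^sup>m = \<surd>q\<close>. Put \<open>z = x\<^sup>Q\<close>, so that \<open>z\<^sup>Q = x\<close>, and let \<open>A\<close> be the partial trace of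
  \<open>x + a / x\<close> over the first \<open>m\<close> exponents. The trace condition says \<open>A(z) = \<theta> - A(x)\<close>. A polynomial
  \<open>\<Psi>(z) = \<Sum> c\<^sub>k\<^sub>i\<^sub>j z\<^sup>k (z\<^sup>Q)\<^sup>i A(z)\<^sup>j\<close> therefore takes the values of \<open>\<Sum> c\<^sub>k\<^sub>i\<^sub>j (x\<^sup>Q)\<^sup>k x\<^sup>i (\<theta> - A(x))\<^sup>j\<close>, which has
  much smaller degree and can be made to vanish identically by a choice of the \<open>c\<^sub>k\<^sub>i\<^sub>j\<close>. The summands of
  \<open>\<Psi>\<close> have distinct degrees, so \<open>\<Psi>\<close> itself is nonzero. In the proof, \<open>At\<close> is \<open>A\<close> multiplied by the
  \<open>w\<close>-th power of its variable to clear the poles at 0.\<close>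

lemma card_trace_fibre_le:
  assumes m: "m > 0" and a: "a \<in> F 1" and \<theta>: "\<theta> \<in> F 1"
  shows "card {x \<in> F (2 * m) - {0}. Tr (2 * m) (x + a / x) = \<theta>} \<le> p ^ m * p ^ (m - 1) + 3 * p ^ m"
proof -
  define w where "w = p ^ (m - 1)"
  define Q where "Q = p ^ m"
  have Qw: "Q = p * w" using m by (cases m) (auto simp: Q_def w_def)
  have w: "w > 0" using p_pos by (simp add: w_def)
  have piw: "p ^ i \<le> w" if "i < m" for i
    using that p_pos unfolding w_def by (intro power_increasing) auto
  define At :: "'c poly" where
    "At = (\<Sum>i<m. Polynomial.monom 1 (w + p ^ i) + Polynomial.monom a (w - p ^ i))"
  have At_PF: "At \<in> PF" unfolding At_def by (intro PF_sum PF_add PF_monom a F_1)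
  have "poly.coeff At (w + w) = (\<Sum>i<m. if i = m - 1 then 1 else 0)"
    unfolding At_def coeff_sum
  proof (intro sum.cong refl)
    fix i assume i: "i \<in> {..<m}"
    have "w + p ^ i = w + w \<longleftrightarrow> i = m - 1"
      using p_gt_1 by (simp add: w_def power_inject_exp)
    moreover have "w - p ^ i \<noteq> w + w" using w by linarith
    ultimately show "poly.coeff (Polynomial.monom 1 (w + p ^ i) + Polynomial.monom a (w - p ^ i)) (w + w)
        = (if i = m - 1 then 1 else 0)" by simp
  qed
  hence lead: "poly.coeff At (2 * w) = 1" using m by (simp add: mult_2)
  have deg_le: "Polynomial.degree At \<le> 2 * w" unfolding At_def
    by (intro degree_sum_le degree_add_le order.trans[OF degree_monom_le]) (use piw in fastforce)+
  have deg_At: "Polynomial.degree At = 2 * w"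
    using deg_le le_degree[of At "2 * w"] lead by simp
  have At0: "At \<noteq> 0" using lead by auto
  have poly_At: "poly At x = x ^ w * Tr m (x + a / x)" if "x \<noteq> 0" for x
  proof -
    have "poly At x = (\<Sum>i<m. x ^ w * (x + a / x) ^ (p ^ i))"
      unfolding At_def poly_sum
    proof (intro sum.cong refl)
      fix i assume i: "i \<in> {..<m}"
      have "a ^ (p ^ i) = a" using a F_1_subset[of i] by (auto simp: F_def)
      moreover have "x ^ (w - p ^ i) = x ^ w / x ^ (p ^ i)"
        using piw[of i] i that by (simp add: power_diff)
      ultimately show "poly (Polynomial.monom 1 (w + p ^ i) + Polynomial.monom a (w - p ^ i)) x =
          x ^ w * (x + a / x) ^ (p ^ i)"
        by (simp add: poly_monom frob_add power_divide power_add ring_distribs)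
    qed
    thus ?thesis by (simp add: Tr_def sum_distrib_left)
  qed

  \<comment> \<open>The degree of \<open>g (k, i, j)\<close> will be a constant plus k + w * (p * i
    + j), so k < w and j < p act as digits. The index i takes w + 2 values so that
    \<open>card S\<close> exceeds the number D + 1 of coefficients even when w = 1.\<close>
  define S where "S = {..<w} \<times> {..<w + 2} \<times> {..<p}"
  \<comment> \<open>The j-th power already clears poles with the w * j-th power of the variable; the
    factor with w * (p - 1 - j) raises this to w * (p - 1) for every index, a common factor that
    cancels at nonzero points.\<close>
  define f where "f = (\<lambda>(k, i, j). Polynomial.monom 1 (Q * k + i + w * (p - 1 - j)) * (Polynomial.monom \<theta> w - At) ^ j)"
  define g where "g = (\<lambda>(k, i, j). Polynomial.monom 1 (k + Q * i + w * (p - 1 - j)) * At ^ j)"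
  have wj: "w * (p - 1 - j) + w * j = w * (p - 1)" if "j < p" for j
    using that by (simp flip: distrib_left)
  have finS: "finite S" by (simp add: S_def)
  have fPF: "f s \<in> PF" for s
    by (auto simp: f_def case_prod_unfold intro!: PF_mult PF_power PF_diff PF_monom At_PF \<theta>[unfolded One_nat_def] F_1)
  \<comment> \<open>This is Q * (w - 1) + (w + 1) + 2 * w * (p - 1), attained at the largest k, i
    and j.\<close>
  define D where "D = Q * w + Q - w + 1"
  have f_deg: "Polynomial.degree (f s) \<le> D" if "s \<in> S" for s
  proof -
    obtain k i j where s: "s = (k, i, j)" by (cases s)
    have kij: "k < w" "i < w + 2" "j < p" using that by (auto simp: S_def s)
    have "Polynomial.degree (Polynomial.monom \<theta> w - At) \<le> 2 * w"
      using deg_At by (intro degree_diff_le order.trans[OF degree_monom_le]) auto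
    hence "Polynomial.degree ((Polynomial.monom \<theta> w - At) ^ j) \<le> 2 * w * j"
      by (intro order.trans[OF degree_power_le]) simp
    hence "Polynomial.degree (f s) \<le> Q * k + i + w * (p - 1 - j) + 2 * w * j"
      unfolding f_def s prod.case
      by (intro order.trans[OF degree_mult_le] add_mono order.trans[OF degree_monom_le]) auto
    also have "\<dots> = Q * k + i + w * (p - 1) + w * j"
      unfolding wj[OF kij(3), symmetric] by simp
    also have "\<dots> \<le> Q * (w - 1) + (w + 1) + w * (p - 1) + w * (p - 1)"
      using kij by (intro add_mono mult_left_mono) auto
    also have "\<dots> \<le> D"
    proof -
      obtain w' p' where [simp]: "w = Suc w'" "p = Suc p'" using w p_pos by (metis gr0_implies_Suc)
      show ?thesis by (simp add: D_def Qw algebra_simps)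
    qed
    finally show ?thesis .
  qed
  have "card S = Q * w + 2 * Q" by (simp add: S_def Qw algebra_simps)
  moreover have "Q \<ge> 2 * w" using p_gt_1 by (simp add: Qw)
  ultimately have cardS: "card S > Suc D" using w unfolding D_def by linarith
  obtain c where "\<And>s. c s \<in> F 1"
      and c: "\<exists>s\<in>S. c s \<noteq> 0" "(\<Sum>s\<in>S. smult (c s) (f s)) = 0"
    by (rule linear_dependence_over_F_1[OF finS cardS fPF f_deg]) (assumption | rule that)+
  define \<Psi> where "\<Psi> = (\<Sum>s\<in>S. smult (c s) (g s))"

  have g_deg: "g s \<noteq> 0 \<and> Polynomial.degree (g s) = w * (p - 1) + k + w * (p * i + j)"
    if "s \<in> S" "s = (k, i, j)" for s k i j
  proof -
    have j: "j < p" using that by (simp add: S_def)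
    have nz: "Polynomial.monom 1 (k + Q * i + w * (p - 1 - j)) \<noteq> (0 :: 'c poly)" "At ^ j \<noteq> 0"
      using At0 by simp_all
    have "Polynomial.degree (g s) = k + Q * i + w * (p - 1 - j) + 2 * w * j"
      using nz At0 unfolding g_def that prod.case
      by (simp add: degree_mult_eq degree_monom_eq degree_power_eq deg_At)
    also have "\<dots> = w * (p - 1) + k + w * (p * i + j)"
      unfolding wj[OF j, symmetric] by (simp add: Qw ring_distribs)
    finally show ?thesis using nz by (simp add: g_def that)
  qed
  have g_inj: "inj_on (\<lambda>s. Polynomial.degree (g s)) S"
  proof (rule inj_onI)
    fix s s' assume s: "s \<in> S" "s' \<in> S" and eq: "Polynomial.degree (g s) = Polynomial.degree (g s')"
    obtain k i j where s1: "s = (k, i, j)" by (cases s)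
    obtain k' i' j' where s2: "s' = (k', i', j')" by (cases s')
    have b: "k < w" "k' < w" "j < p" "j' < p" using s by (auto simp: S_def s1 s2)
    have e: "k + w * (p * i + j) = k' + w * (p * i' + j')"
      using eq g_deg[OF s(1) s1] g_deg[OF s(2) s2] by simp
    have "k = k'" using arg_cong[OF e, of "\<lambda>u. u mod w"] b by simp
    moreover have e2: "p * i + j = p * i' + j'" using e \<open>k = k'\<close> w by simp
    moreover have "j = j'" using arg_cong[OF e2, of "\<lambda>u. u mod p"] b by simp
    moreover have "i = i'" using e2 \<open>j = j'\<close> p_pos by simp
    ultimately show "s = s'" by (simp add: s1 s2)
  qed
  have "\<Psi> = (\<Sum>s\<in>{s \<in> S. c s \<noteq> 0}. smult (c s) (g s))"
    unfolding \<Psi>_def using finS by (intro sum.mono_neutral_right) auto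
  also have "\<dots> \<noteq> 0"
  proof (rule sum_distinct_degrees_neq_0)
    show "inj_on (\<lambda>s. Polynomial.degree (smult (c s) (g s))) {s \<in> S. c s \<noteq> 0}"
      using g_inj by (auto simp: inj_on_def)
    show "smult (c s) (g s) \<noteq> 0" if "s \<in> {s \<in> S. c s \<noteq> 0}" for s
      using that g_deg[of s] by (cases s) auto
  qed (use finS c in auto)
  finally have \<Psi>0: "\<Psi> \<noteq> 0" .
  \<comment> \<open>Q * w is the expected fibre size p^(2m) / p. The clearing factor, the last value
    w + 1 of i, and k + w * j cost at most one further Q each.\<close>
  have "Polynomial.degree \<Psi> \<le> Q * w + 3 * Q"
    unfolding \<Psi>_def
  proof (intro degree_sum_le finS order.trans[OF degree_smult_le])
    fix s assume s: "s \<in> S"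
    obtain k i j where s1: "s = (k, i, j)" by (cases s)
    have b: "k < w" "i < w + 2" "j < p" using s by (auto simp: S_def s1)
    have "Polynomial.degree (g s) = w * (p - 1) + k + w * (p * i + j)"
      using g_deg[OF s s1] by simp
    also have "\<dots> \<le> w * p + w + w * (p * (w + 1) + (p - 1))"
      using b by (intro add_mono mult_left_mono) auto
    also have "\<dots> = Q * w + 3 * Q"
    proof -
      obtain p' where [simp]: "p = Suc p'" using p_pos by (metis gr0_implies_Suc)
      show ?thesis by (simp add: Qw algebra_simps)
    qed
    finally show "Polynomial.degree (g s) \<le> Q * w + 3 * Q" .
  qed
  moreover have "card {x \<in> F (2 * m) - {0}. Tr (2 * m) (x + a / x) = \<theta>} \<le> card {z. poly \<Psi> z = 0}"
  proof (rule card_inj_on_le)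
    show "finite {z. poly \<Psi> z = 0}" by (rule poly_roots_finite[OF \<Psi>0])
    have invol: "(x ^ Q) ^ Q = x" if "x \<in> F (2 * m)" for x
      using that by (simp add: F_def Q_def frob_frob mult_2)
    thus "inj_on (\<lambda>x. x ^ Q) {x \<in> F (2 * m) - {0}. Tr (2 * m) (x + a / x) = \<theta>}"
      by (intro inj_onI) (metis (lifting) DiffD1 mem_Collect_eq)
    show "(\<lambda>x. x ^ Q) ` {x \<in> F (2 * m) - {0}. Tr (2 * m) (x + a / x) = \<theta>} \<subseteq> {z. poly \<Psi> z = 0}"
    proof (rule image_subsetI)
      fix x assume "x \<in> {x \<in> F (2 * m) - {0}. Tr (2 * m) (x + a / x) = \<theta>}"
      hence x: "x \<in> F (2 * m)" "x \<noteq> 0" and \<theta>_eq: "\<theta> = Tr (2 * m) (x + a / x)"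
        by auto
      define z where "z = x ^ Q"
      have z: "z \<noteq> 0" "z ^ Q = x" using x invol by (auto simp: z_def)
      have aQ: "a ^ Q = a" using a F_1_subset[of m] by (auto simp: F_def Q_def)
      define A where "A = Tr m (x + a / x)"
      have "(x + a / x) ^ (p ^ m) = z + a / z"
        by (simp add: frob_add power_divide z_def Q_def aQ[unfolded Q_def])
      hence "\<theta> = A + Tr m (z + a / z)"
        using \<theta>_eq Tr_double[of m "x + a / x"] Tr_add[of m "x + a / x" "(x + a / x) ^ (p ^ m)"]
        by (simp only: A_def)
      hence "Tr m (z + a / z) = \<theta> - A"
        by (metis add_diff_cancel_left')
      hence At_z: "poly At z = z ^ w * (\<theta> - A)" using poly_At z by simp
      have At_x: "poly (Polynomial.monom \<theta> w - At) x = x ^ w * (\<theta> - A)"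
        using x by (simp add: poly_monom poly_At A_def algebra_simps)
      \<comment> \<open>Up to a power of x or z that is the same for all s, this is the value of
        \<open>f s\<close> at x and of \<open>g s\<close> at z; hence the linear relation between
        the \<open>f s\<close> makes \<Psi> vanish at z.\<close>
      define h where "h = (\<lambda>(k, i, j). z ^ k * x ^ i * (\<theta> - A) ^ j)"
      have f_x: "poly (f s) x = x ^ (w * (p - 1)) * h s" if "s \<in> S" for s
      proof -
        obtain k i j where s: "s = (k, i, j)" by (cases s)
        have j: "j < p" using that by (simp add: S_def s)
        have "poly (f s) x = x ^ (Q * k) * x ^ i * x ^ (w * (p - 1 - j)) * (x ^ (w * j) * (\<theta> - A) ^ j)"
          by (simp add: f_def s poly_monom At_x power_add power_mult_distrib flip: power_mult del: poly_diff)
        also have "\<dots> = x ^ (w * (p - 1 - j) + w * j) * h s"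
          by (simp add: h_def s z_def power_add power_mult)
        finally show ?thesis by (simp only: wj[OF j])
      qed
      have g_z: "poly (g s) z = z ^ (w * (p - 1)) * h s" if "s \<in> S" for s
      proof -
        obtain k i j where s: "s = (k, i, j)" by (cases s)
        have j: "j < p" using that by (simp add: S_def s)
        have "poly (g s) z = z ^ k * z ^ (Q * i) * z ^ (w * (p - 1 - j)) * (z ^ (w * j) * (\<theta> - A) ^ j)"
          by (simp add: g_def s poly_monom At_z power_add power_mult_distrib flip: power_mult)
        also have "\<dots> = z ^ (w * (p - 1 - j) + w * j) * h s"
          by (simp add: h_def s z(2) power_add power_mult)
        finally show ?thesis by (simp only: wj[OF j])
      qed
      have "0 = poly (\<Sum>s\<in>S. smult (c s) (f s)) x" using c by simp
      also have "\<dots> = (\<Sum>s\<in>S. c s * (x ^ (w * (p - 1)) * h s))"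
        unfolding poly_sum poly_smult by (intro sum.cong refl) (simp add: f_x)
      also have "\<dots> = x ^ (w * (p - 1)) * (\<Sum>s\<in>S. c s * h s)"
        by (simp only: sum_distrib_left mult.left_commute)
      finally have 0: "(\<Sum>s\<in>S. c s * h s) = 0" using x by simp
      have "poly \<Psi> z = (\<Sum>s\<in>S. c s * (z ^ (w * (p - 1)) * h s))"
        unfolding \<Psi>_def poly_sum poly_smult by (intro sum.cong refl) (simp add: g_z)
      also have "\<dots> = z ^ (w * (p - 1)) * (\<Sum>s\<in>S. c s * h s)"
        by (simp only: sum_distrib_left mult.left_commute)
      finally show "x ^ Q \<in> {z. poly \<Psi> z = 0}" using 0 by (simp add: z_def)
    qed
  qed
  ultimately show ?thesis
    using card_poly_roots_bound[OF \<Psi>0] by (simp add: Q_def w_def)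
qed

subsection \<open>The bound for Kloosterman sums\<close>

text \<open>As \<open>psi\<close> sums to 0 over \<open>F 1\<close>, all fibre sizes may be lowered
  by their upper bound M. The differences then have one sign, so their absolute values add up to p *
  M - card E, where the terms p^(2m) cancel.\<close>

lemma norm_K_even_le:
  assumes m: "m > 0" and a: "a \<in> F 1"
  shows "norm (K a (2 * m)) \<le> 4 * real p * real p ^ m"
proof -
  define M where "M = p ^ m * p ^ (m - 1) + 3 * p ^ m"
  define E where "E = F (2 * m) - {0}"
  define T where "T = (\<lambda>x. Tr (2 * m) (x + a / x))"
  define N where "N = (\<lambda>\<theta>. card {x \<in> E. T x = \<theta>})"
  have fin: "finite E" using card_F(1)[of "2 * m"] m by (simp add: E_def)
  have fin1: "finite (F 1)" "card (F 1) = p" using card_F[of 1] by auto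
  have cardE: "card E = p ^ (2 * m) - 1"
    using card_F[of "2 * m"] m by (simp add: E_def F_0)
  have TE: "T ` E \<subseteq> F 1"
    using a F_1_subset by (auto simp: T_def E_def simp del: One_nat_def intro!: Tr_in_F_1 F_add F_divide)
  have NM: "N \<theta> \<le> M" if "\<theta> \<in> F 1" for \<theta>
    using card_trace_fibre_le[OF m a that] by (simp add: N_def M_def E_def T_def)
  have "K a (2 * m) = (\<Sum>x\<in>E. psi (T x))"
    by (simp add: K_def E_def T_def)
  also have "\<dots> = (\<Sum>\<theta>\<in>F 1. \<Sum>x\<in>{x \<in> E. T x = \<theta>}. psi (T x))"
    by (rule sum.group[symmetric]) (use fin fin1 TE in auto)
  also have "\<dots> = (\<Sum>\<theta>\<in>F 1. of_nat (N \<theta>) * psi \<theta>)"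
    by (intro sum.cong) (auto simp: N_def)
  also have "\<dots> = (\<Sum>\<theta>\<in>F 1. of_nat (N \<theta>) * psi \<theta>) - of_nat M * (\<Sum>\<theta>\<in>F 1. psi \<theta>)"
    using sum_psi_Tr_0[of 1 1] F_1[of 1] by (simp add: Tr_def)
  also have "\<dots> = (\<Sum>\<theta>\<in>F 1. (of_nat (N \<theta>) - of_nat M) * psi \<theta>)"
    by (simp add: sum_distrib_left sum_subtractf left_diff_distrib)
  finally have "norm (K a (2 * m)) \<le> (\<Sum>\<theta>\<in>F 1. norm ((of_nat (N \<theta>) - of_nat M) * psi \<theta>))"
    by (simp only: norm_sum)
  also have "\<dots> = (\<Sum>\<theta>\<in>F 1. real M - real (N \<theta>))"
  proof (intro sum.cong refl)
    fix \<theta> assume "\<theta> \<in> F 1"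
    hence "N \<theta> \<le> M" by (rule NM)
    moreover have "norm (of_nat (N \<theta>) - of_nat M :: complex) = \<bar>real (N \<theta>) - real M\<bar>"
      by (metis norm_of_real of_real_diff of_real_of_nat_eq)
    ultimately show "norm ((of_nat (N \<theta>) - of_nat M) * psi \<theta>) = real M - real (N \<theta>)"
      by (simp add: norm_mult norm_psi)
  qed
  also have "\<dots> = real p * real M - real (\<Sum>\<theta>\<in>F 1. N \<theta>)"
    using fin1 by (simp add: sum_subtractf)
  also have "(\<Sum>\<theta>\<in>F 1. N \<theta>) = card E"
    using sum.group[OF fin fin1(1) TE, of "\<lambda>_. 1 :: nat"] by (simp add: N_def)
  also have "real p * real M - real (card E) = 3 * real p * real p ^ m + 1"
  proof -
    have e: "p * p ^ (m - 1) = p ^ m" using m by (cases m) auto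
    have "p * M = p ^ m * (p * p ^ (m - 1)) + 3 * p * p ^ m"
      by (simp only: M_def distrib_left ac_simps)
    hence "p * M = p ^ (2 * m) + 3 * p * p ^ m"
      unfolding e by (simp add: mult_2 power_add)
    hence "real p * real M = real p ^ (2 * m) + 3 * real p * real p ^ m"
      by (metis (mono_tags, lifting) of_nat_add of_nat_mult of_nat_numeral of_nat_power)
    moreover have "real (card E) = real p ^ (2 * m) - 1"
      unfolding cardE using q_pos[of "2 * m"] by (simp add: of_nat_diff Suc_leI)
    ultimately show ?thesis by simp
  qed
  also have "\<dots> \<le> 4 * real p * real p ^ m"
  proof -
    have "1 \<le> p * p ^ m" using p_pos by (simp add: Suc_leI)
    hence "1 \<le> real p * real p ^ m" by (metis of_nat_1 of_nat_le_iff of_nat_mult of_nat_power)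
    thus ?thesis by simp
  qed
  finally show ?thesis .
qed

text \<open>By the doubling formula \<open>t = \<bar>K\<bar> / \<surd>q\<close> satisfies \<open>t' \<ge> t\<^sup>2 - 2\<close>, so that a value above 2 would
  make it grow without bound along the tower of quadratic extensions.\<close>

lemma norm_K_le:
  assumes a: "a \<in> F 1" "a \<noteq> 0"
  shows "norm (K a 1) \<le> 2 * sqrt (real p)"
proof (rule ccontr)
  assume large: "\<not> ?thesis"
  define t where "t = (\<lambda>k. norm (K a (2 ^ k)) / sqrt (real p ^ (2 ^ k)))"
  define \<delta> where "\<delta> = t 0 - 2"
  have sq: "sqrt (real p ^ (2 ^ k)) > 0" for k using p_pos by simp
  have \<delta>: "\<delta> > 0" using large sq[of 0] by (simp add: \<delta>_def t_def field_simps)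
  have sqrt_q: "sqrt (real p ^ (2 ^ Suc k)) = real p ^ (2 ^ k)" for k
  proof -
    have "real p ^ (2 ^ Suc k) = (real p ^ (2 ^ k))\<^sup>2"
      by (simp only: power_mult[symmetric] power_Suc2)
    thus ?thesis by (simp only: real_sqrt_abs) simp
  qed
  have step: "t (Suc k) \<ge> (t k)\<^sup>2 - 2" for k
  proof -
    let ?q = "real p ^ (2 ^ k)"
    have q: "?q > 0" using p_pos by simp
    have eq: "K a (2 * 2 ^ k) = 2 * of_nat (p ^ (2 ^ k)) - (K a (2 ^ k))\<^sup>2"
      by (rule K_double) (use a in auto)
    have "norm ((K a (2 ^ k))\<^sup>2) - norm (2 * of_nat (p ^ (2 ^ k)) :: complex) \<le> norm (K a (2 * 2 ^ k))"
      unfolding eq by (metis norm_minus_commute norm_triangle_ineq2)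
    hence "(norm (K a (2 ^ k)))\<^sup>2 - 2 * ?q \<le> norm (K a (2 * 2 ^ k))"
      by (simp add: norm_power norm_mult)
    hence "((norm (K a (2 ^ k)))\<^sup>2 - 2 * ?q) / ?q \<le> norm (K a (2 * 2 ^ k)) / ?q"
      using q by (intro divide_right_mono) auto
    hence "(norm (K a (2 ^ k)))\<^sup>2 / ?q - 2 \<le> norm (K a (2 * 2 ^ k)) / ?q"
      using q by (simp add: diff_divide_distrib)
    moreover have "(t k)\<^sup>2 = (norm (K a (2 ^ k)))\<^sup>2 / ?q"
      using q by (simp add: t_def power_divide)
    moreover have "t (Suc k) = norm (K a (2 * 2 ^ k)) / ?q"
      unfolding t_def sqrt_q by simp
    ultimately show ?thesis by simp
  qed
  have grow: "t k - 2 \<ge> 4 ^ k * \<delta>" for k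
  proof (induction k)
    case (Suc k)
    \<comment> \<open>The two sides differ by (t k - 2)^2; together with \<open>step\<close> this
      quadruples the excess over 2.\<close>
    have "4 * (t k - 2) \<le> (t k)\<^sup>2 - 4"
      using zero_le_power2[of "t k - 2"] by (simp add: power2_eq_square algebra_simps)
    with step[of k] Suc show ?case by simp
  qed (simp add: \<delta>_def)
  \<comment> \<open>All levels but the lowest have an even exponent, where the fibre count applies
    and leaves a constant independent of k.\<close>
  have bound: "t (Suc k) \<le> 4 * real p" for k
    unfolding t_def sqrt_q using norm_K_even_le[of "2 ^ k" a] a p_pos
    by (simp add: divide_le_eq)
  obtain k where "(4 * real p) / \<delta> < 4 ^ k"
    using real_arch_pow[of 4 "4 * real p / \<delta>"] by auto
  also have "(4::real) ^ k \<le> 4 ^ Suc k" by (rule power_increasing) auto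
  finally have "4 * real p < 4 ^ Suc k * \<delta>" using \<delta> by (simp add: field_simps)
  also have "\<dots> \<le> t (Suc k)" using grow[of "Suc k"] by simp
  finally show False using bound[of k] by simp
qed

text \<open>\<open>inv'\<close> may be any choice of representatives, since a later substitution
  produces inverses that are not reduced modulo p.\<close>

lemma norm_kloosterman_le:
  fixes inv' :: "nat \<Rightarrow> nat"
  assumes a: "\<not> p dvd a" and inv': "\<And>s. s \<in> {1..<p} \<Longrightarrow> [s * inv' s = 1] (mod p)"
  shows "norm (\<Sum>s=1..<p. cis (2 * pi * real (s + a * inv' s) / real p)) \<le> 2 * sqrt (real p)"
proof -
  have a0: "of_nat a \<noteq> (0::'c)" using a by (simp add: of_nat_eq_0_iff_char_dvd p_eq)
  note inj = inj_on_of_nat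
  have "F 1 - {0} = of_nat ` ({..<p} - {0})"
    using inj_on_image_set_diff[OF inj, of "{..<p}" "{0}"] p_pos by (simp add: F_1_eq)
  also have "{..<p} - {0} = {1..<p}" by auto
  finally have F: "F 1 - {0} = of_nat ` {1..<p}" .
  have "K (of_nat a) 1 = (\<Sum>s\<in>{1..<p}. psi (of_nat s + of_nat a / of_nat s))"
    unfolding K_def F by (subst sum.reindex) (auto intro: inj_on_subset[OF inj] simp: Tr_def)
  also have "\<dots> = (\<Sum>s=1..<p. cis (2 * pi * real (s + a * inv' s) / real p))"
  proof (intro sum.cong refl)
    fix s assume s: "s \<in> {1..<p}"
    have "of_nat (s * inv' s) = (of_nat 1 :: 'c)"
      using inv'[OF s] unfolding of_nat_eq_iff_cong_CHAR p_eq .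
    hence "inverse (of_nat s) = (of_nat (inv' s) :: 'c)" by (intro inverse_unique) simp
    hence "of_nat s + of_nat a / of_nat s = (of_nat (s + a * inv' s) :: 'c)"
      by (simp add: divide_inverse)
    thus "psi (of_nat s + of_nat a / of_nat s) = cis (2 * pi * real (s + a * inv' s) / real p)"
      by (simp only: psi_of_nat)
  qed
  finally show ?thesis using norm_K_le[of "of_nat a"] a0 F_of_nat by simp
qed

end

section \<open>From one algebraically closed field to every prime\<close>

lemma kloosterman_bound_char:
  fixes inv' :: "nat \<Rightarrow> nat"
  assumes "CHAR('c::alg_closed_field) = p" "prime p"
    and "\<not> p dvd a" "\<And>s. s \<in> {1..<p} \<Longrightarrow> [s * inv' s = 1] (mod p)"
  shows "norm (\<Sum>s=1..<p. cis (2 * pi * real (s + a * inv' s) / real p)) \<le> 2 * sqrt (real p)"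
proof -
  interpret char_p_closure p "TYPE('c)"
    using assms by unfold_locales auto
  show ?thesis using norm_kloosterman_le assms by blast
qed

text \<open>A type cannot depend on a prime that is fixed inside a proof. Therefore the type is built for one
  globally defined prime, which is a counterexample to the bound if there is any.\<close>

definition kloosterman_bound :: "nat \<Rightarrow> bool" where
  "kloosterman_bound p \<longleftrightarrow> (\<forall>a inv'. \<not> p dvd a \<longrightarrow> (\<forall>s\<in>{1..<p}. [s * inv' s = 1] (mod p)) \<longrightarrow>
     norm (\<Sum>s=1..<p. cis (2 * pi * real (s + a * inv' s) / real p)) \<le> 2 * sqrt (real p))"

definition bad_prime :: nat where
  "bad_prime = (if \<exists>p. prime p \<and> \<not> kloosterman_bound p
                then SOME p. prime p \<and> \<not> kloosterman_bound p else 2)"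

lemma prime_bad_prime: "prime bad_prime"
  and kloosterman_bound_if_bad_prime: "kloosterman_bound bad_prime \<Longrightarrow> prime p \<Longrightarrow> kloosterman_bound p"
proof -
  have *: "prime bad_prime \<and> \<not> kloosterman_bound bad_prime" if "\<exists>p. prime p \<and> \<not> kloosterman_bound p"
    using someI_ex[OF that] that unfolding bad_prime_def by simp
  show "prime bad_prime" using * by (auto simp: bad_prime_def)
  show "kloosterman_bound p" if "kloosterman_bound bad_prime" "prime p" using * that by blast
qed

text \<open>Its \<open>prime_card\<close> instance makes \<open>bad_index mod_ring\<close> a field
  of \<open>bad_prime\<close> elements, which then has an algebraic closure.\<close>

typedef bad_index = "{..<bad_prime}"
  using prime_gt_0_nat[OF prime_bad_prime] by blast

lemma card_bad_index: "CARD(bad_index) = bad_prime"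
  using type_definition.card[OF type_definition_bad_index] by simp

instance bad_index :: prime_card
  by standard (simp add: card_bad_index prime_bad_prime)

theorem kloosterman_bound:
  assumes "prime p"
  shows "kloosterman_bound p"
proof (rule kloosterman_bound_if_bad_prime[OF _ assms])
  have "CHAR(bad_index mod_ring alg_closure) = bad_prime"
    by (simp add: card_bad_index)
  thus "kloosterman_bound bad_prime"
    using kloosterman_bound_char[OF _ prime_bad_prime] unfolding kloosterman_bound_def by blast
qed

section \<open>Discrepancy and exponential sums\<close>

definition unity_char :: "nat \<Rightarrow> int \<Rightarrow> complex" where
  "unity_char p x = cis (2 * pi * of_int x / real p)"

lemma unity_char_0 [simp]: "unity_char p 0 = 1"
  by (simp add: unity_char_def)

lemma norm_unity_char [simp]: "norm (unity_char p x) = 1"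
  by (simp add: unity_char_def)

lemma unity_char_add: "unity_char p (x + y) = unity_char p x * unity_char p y"
  by (simp add: unity_char_def cis_mult ring_distribs add_divide_distrib)

lemma unity_char_power: "unity_char p x ^ k = unity_char p (int k * x)"
  unfolding unity_char_def Complex.DeMoivre by (simp add: mult.left_commute)

lemma unity_char_cong:
  assumes "p > 0" "[x = y] (mod int p)"
  shows "unity_char p x = unity_char p y"
proof -
  have "int p dvd x - y" using assms(2) by (simp add: cong_iff_dvd_diff)
  then obtain k where "x - y = int p * k" by (rule dvdE)
  hence k: "x = y + int p * k" by simp
  have "2 * pi * of_int (int p * k) / real p = 2 * pi * of_int k"
    using assms(1) by simp
  hence "unity_char p (int p * k) = cis (2 * pi * of_int k)"
    by (simp only: unity_char_def)
  also have "\<dots> = 1" by (rule cis_multiple_2pi) simp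
  finally show ?thesis by (simp add: k unity_char_add)
qed

lemma unity_char_eq_1_iff:
  assumes "p > 0"
  shows "unity_char p x = 1 \<longleftrightarrow> int p dvd x"
proof
  assume "unity_char p x = 1"
  hence "cos (2 * pi * of_int x / real p) = 1"
    unfolding unity_char_def by (metis cis.simps(1) one_complex.simps(1))
  then obtain m :: int where "2 * pi * of_int x / real p = of_int m * 2 * pi"
    by (auto simp: cos_one_2pi_int)
  hence "of_int x = of_int m * real p" using assms by (simp add: field_simps)
  hence "x = m * int p" by (metis of_int_eq_iff of_int_mult of_int_of_nat_eq)
  thus "int p dvd x" by simp
next
  assume "int p dvd x"
  hence "[x = 0] (mod int p)" by (simp add: cong_0_iff)
  from unity_char_cong[OF assms this] show "unity_char p x = 1" by simp
qed

lemma sum_unity_char: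
  assumes "p > 0"
  shows "(\<Sum>s<p. unity_char p (u * int s)) = (if int p dvd u then of_nat p else 0)"
proof (cases "int p dvd u")
  case True
  have "unity_char p (u * int s) = 1" for s
    using True assms by (simp add: unity_char_eq_1_iff)
  thus ?thesis using True by simp
next
  case False
  have ne: "unity_char p u \<noteq> 1" using False assms by (simp add: unity_char_eq_1_iff)
  have "(\<Sum>s<p. unity_char p (u * int s)) = (\<Sum>s<p. unity_char p u ^ s)"
    by (simp add: unity_char_power mult.commute)
  also have "\<dots> = (unity_char p u ^ p - 1) / (unity_char p u - 1)"
    by (rule geometric_sum[OF ne])
  also have "unity_char p u ^ p = 1"
    using assms by (simp add: unity_char_power unity_char_eq_1_iff)
  finally show ?thesis using False by simp
qed

text \<open>The frequencies \<open>(0, v)\<close> and \<open>(u, 0)\<close> contribute nothing because \<open>\<sigma>\<close> is a bijection, which is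
  why only nonzero \<open>u\<close> and \<open>v\<close> appear in the hypothesis and in the sums.\<close>

lemma disc_le_fourier:
  fixes \<sigma> :: "nat \<Rightarrow> nat"
  assumes p: "p > 0" and \<sigma>: "bij_betw \<sigma> {..<p} {..<p}"
    and I: "I \<subseteq> {..<p}" and J: "J \<subseteq> {..<p}"
    and B: "\<And>u v. u \<in> {1..<p} \<Longrightarrow> v \<in> {1..<p} \<Longrightarrow>
              norm (\<Sum>s<p. unity_char p (int u * int s + int v * int (\<sigma> s))) \<le> B"
  shows "disc p (\<sigma> ` I) J \<le> B / (real p)\<^sup>2 *
           (\<Sum>u=1..<p. norm (\<Sum>x\<in>I. unity_char p (- int u * int x))) *
           (\<Sum>v=1..<p. norm (\<Sum>y\<in>J. unity_char p (- int v * int y)))"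
proof -
  define a where "a = (\<lambda>u::nat. \<Sum>x\<in>I. unity_char p (- int u * int x))"
  define b where "b = (\<lambda>v::nat. \<Sum>y\<in>J. unity_char p (- int v * int y))"
  define T where "T = (\<lambda>u v. \<Sum>s<p. unity_char p (int u * int s + int v * int (\<sigma> s)))"
  define N where "N = card {s \<in> I. \<sigma> s \<in> J}"
  \<comment> \<open>Fourier inversion for the indicator function of A, multiplied by p.\<close>
  have ind: "(\<Sum>u<p. unity_char p (int u * int s) * (\<Sum>x\<in>A. unity_char p (- int u * int x)))
      = (if s \<in> A then of_nat p else 0)"
    if s: "s < p" and A: "A \<subseteq> {..<p}" for s A
  proof -
    have "(\<Sum>u<p. unity_char p (int u * int s) * (\<Sum>x\<in>A. unity_char p (- int u * int x)))
        = (\<Sum>x\<in>A. \<Sum>u<p. unity_char p ((int s - int x) * int u))"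
      unfolding sum_distrib_left
      by (subst sum.swap) (intro sum.cong refl, simp add: unity_char_add[symmetric] algebra_simps)
    also have "\<dots> = (\<Sum>x\<in>A. if x = s then of_nat p else 0)"
    proof (intro sum.cong refl)
      fix x assume "x \<in> A"
      hence "x < p" using A by auto
      hence "int p dvd int s - int x \<longleftrightarrow> x = s"
        using s by (auto simp: mod_eq_dvd_iff[symmetric])
      thus "(\<Sum>u<p. unity_char p ((int s - int x) * int u)) = (if x = s then of_nat p else 0)"
        by (simp add: sum_unity_char[OF p])
    qed
    also have "\<dots> = (if s \<in> A then of_nat p else 0)"
      using finite_subset[OF A] by simp
    finally show ?thesis .
  qed
  have \<sigma>_lt: "\<sigma> s < p" if "s < p" for s using \<sigma> that by (auto simp: bij_betw_def)
  have "(\<Sum>u<p. \<Sum>v<p. a u * b v * T u v) =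
      (\<Sum>s<p. (\<Sum>u<p. unity_char p (int u * int s) * a u) * (\<Sum>v<p. unity_char p (int v * int (\<sigma> s)) * b v))"
  proof -
    have "(\<Sum>s<p. (\<Sum>u<p. unity_char p (int u * int s) * a u) * (\<Sum>v<p. unity_char p (int v * int (\<sigma> s)) * b v))
        = (\<Sum>s<p. \<Sum>u<p. \<Sum>v<p. a u * b v * unity_char p (int u * int s + int v * int (\<sigma> s)))"
      unfolding sum_product by (intro sum.cong refl) (simp add: unity_char_add)
    also have "\<dots> = (\<Sum>u<p. \<Sum>s<p. \<Sum>v<p. a u * b v * unity_char p (int u * int s + int v * int (\<sigma> s)))"
      by (rule sum.swap)
    also have "\<dots> = (\<Sum>u<p. \<Sum>v<p. \<Sum>s<p. a u * b v * unity_char p (int u * int s + int v * int (\<sigma> s)))"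
      by (intro sum.cong refl sum.swap)
    finally show ?thesis by (simp add: T_def sum_distrib_left)
  qed
  also have "\<dots> = (\<Sum>s<p. if s \<in> I \<and> \<sigma> s \<in> J then (of_nat p)\<^sup>2 else 0)"
  proof (intro sum.cong refl)
    fix s assume "s \<in> {..<p}"
    hence s: "s < p" by simp
    show "(\<Sum>u<p. unity_char p (int u * int s) * a u) * (\<Sum>v<p. unity_char p (int v * int (\<sigma> s)) * b v)
        = (if s \<in> I \<and> \<sigma> s \<in> J then (of_nat p)\<^sup>2 else 0)"
      unfolding a_def b_def ind[OF s I] ind[OF \<sigma>_lt[OF s] J] by (simp add: power2_eq_square)
  qed
  also have "\<dots> = of_nat N * (of_nat p)\<^sup>2"
  proof -
    have "{s \<in> {..<p}. s \<in> I \<and> \<sigma> s \<in> J} = {s \<in> I. \<sigma> s \<in> J}" using I by auto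
    thus ?thesis by (simp add: N_def flip: sum.inter_filter)
  qed
  finally have N_eq: "of_nat N * (of_nat p)\<^sup>2 = (\<Sum>u<p. \<Sum>v<p. a u * b v * T u v)" by simp
  have split: "(\<Sum>u<p. g u) = g 0 + (\<Sum>u=1..<p. g u)" for g :: "nat \<Rightarrow> complex"
    using p by (simp add: lessThan_atLeast0 sum.atLeast_Suc_lessThan)
  have T00: "T 0 0 = of_nat p" by (simp add: T_def)
  have ndvd: "\<not> int p dvd int u" if "u \<in> {1..<p}" for u
    using that by (auto dest: zdvd_imp_le)
  have Tu0: "T u 0 = 0" if "u \<in> {1..<p}" for u
    using sum_unity_char[OF p, of "int u"] ndvd[OF that] by (simp add: T_def)
  have T0v: "T 0 v = 0" if "v \<in> {1..<p}" for v
  proof -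
    have "T 0 v = (\<Sum>s<p. unity_char p (int v * int s))"
      unfolding T_def using sum.reindex_bij_betw[OF \<sigma>, of "\<lambda>s. unity_char p (int v * int s)"] by simp
    thus ?thesis using sum_unity_char[OF p, of "int v"] ndvd[OF that] by simp
  qed
  \<comment> \<open>The frequency (0, 0) contributes p^2 times the expected count subtracted in
    \<open>disc\<close>.\<close>
  have "(\<Sum>u<p. \<Sum>v<p. a u * b v * T u v) =
      of_nat (card I) * of_nat (card J) * of_nat p + (\<Sum>u=1..<p. \<Sum>v=1..<p. a u * b v * T u v)"
    unfolding split using Tu0 T0v by (simp add: T00 sum.distrib a_def b_def)
  hence eq: "of_nat N * (of_nat p)\<^sup>2 - of_nat (card I) * of_nat (card J) * of_nat p =
      (\<Sum>u=1..<p. \<Sum>v=1..<p. a u * b v * T u v)"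
    using N_eq by simp
  have inj: "inj_on \<sigma> I" using \<sigma> I by (auto simp: bij_betw_def intro: inj_on_subset)
  have cI: "card (\<sigma> ` I) = card I" by (rule card_image[OF inj])
  have "\<sigma> ` I \<inter> J = \<sigma> ` {s \<in> I. \<sigma> s \<in> J}" by auto
  hence cN: "card (\<sigma> ` I \<inter> J) = N"
    unfolding N_def by (metis (no_types, lifting) card_image inj inj_on_subset mem_Collect_eq subsetI)
  have "disc p (\<sigma> ` I) J * (real p)\<^sup>2 =
      \<bar>(real N - real (card I) * real (card J) / real p) * (real p)\<^sup>2\<bar>"
    by (simp add: disc_def cI cN abs_mult)
  also have "(real N - real (card I) * real (card J) / real p) * (real p)\<^sup>2 =
      real N * (real p)\<^sup>2 - real (card I) * real (card J) * real p"
    using p by (simp add: field_simps power2_eq_square)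
  also have "\<bar>\<dots>\<bar> = norm (of_nat N * (of_nat p)\<^sup>2 - of_nat (card I) * of_nat (card J) * of_nat p :: complex)"
    by (simp only: norm_of_real[symmetric, where 'a = complex] of_real_diff of_real_mult of_real_power of_real_of_nat_eq)
  also have "\<dots> \<le> (\<Sum>u=1..<p. \<Sum>v=1..<p. norm (a u) * norm (b v) * B)"
    unfolding eq
  proof (intro order.trans[OF norm_sum] sum_mono)
    fix u v assume "u \<in> {1..<p}" "v \<in> {1..<p}"
    hence "norm (T u v) \<le> B" unfolding T_def by (rule B)
    thus "norm (a u * b v * T u v) \<le> norm (a u) * norm (b v) * B"
      by (simp add: norm_mult mult_left_mono)
  qed
  also have "\<dots> = B * (\<Sum>u=1..<p. norm (a u)) * (\<Sum>v=1..<p. norm (b v))"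
    by (simp add: sum_product sum_distrib_left mult_ac)
  finally have "disc p (\<sigma> ` I) J \<le> (B * (\<Sum>u=1..<p. norm (a u)) * (\<Sum>v=1..<p. norm (b v))) / (real p)\<^sup>2"
    using p by (simp add: field_simps)
  thus ?thesis by (simp add: a_def b_def)
qed

section \<open>Fourier coefficients of intervals\<close>

lemma sin_ge_quarter:
  fixes t :: real
  assumes "0 \<le> t" "t \<le> pi / 2"
  shows "sin t \<ge> t / 4"
\<comment> \<open>Up to pi / 3 the cosine is at least 1/2, so sin t \<ge> t / 2 by the mean value
  theorem; beyond, sin t \<ge> 1/2 \<ge> t / 4.\<close>
proof (cases "t \<le> pi / 3")
  case True
  show ?thesis
  proof (cases "t = 0")
    case False
    hence t: "0 < t" using assms by simp
    have "\<exists>z>0. z < t \<and> sin t - sin 0 = (t - 0) * cos z"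
      by (rule MVT2[OF t]) (auto intro!: derivative_eq_intros)
    then obtain z where z: "0 < z" "z < t" "sin t = t * cos z" by auto
    have "cos (pi / 3) \<le> cos z" using z True by (intro cos_monotone_0_pi_le) auto
    hence "t * (1 / 2) \<le> t * cos z" using t by (intro mult_left_mono) (auto simp: cos_60)
    thus ?thesis using z t by simp
  qed simp
next
  case False
  have "1 / 2 \<le> sin t"
    using sin_monotone_2pi_le[of "pi / 6" t] False assms by (simp add: sin_30)
  moreover have "t \<le> 2" using assms pi_less_4 by simp
  ultimately show ?thesis by simp
qed

text \<open>A geometric sum of ratio \<open>z\<close> is at most \<open>2 / \<bar>z - 1\<bar> = 1 / sin (\<pi> u / p)\<close>; adding the bounds for \<open>u \<le> p / 2\<close>
  and \<open>u \<ge> p / 2\<close> avoids a case distinction when summing over \<open>u\<close>.\<close>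

lemma norm_geometric_unity_char_le:
  assumes u: "u \<in> {1..<p}"
  shows "norm (\<Sum>j<k. unity_char p (- int u) ^ j) \<le> 2 * real p / real u + 2 * real p / real (p - u)"
proof -
  define z where "z = unity_char p (- int u)"
  define t where "t = pi * real u / real p"
  have p: "p > 0" using u by simp
  have "\<not> int p dvd - int u" using u by (auto dest: zdvd_imp_le)
  hence z1: "z \<noteq> 1" using p by (simp add: z_def unity_char_eq_1_iff)
  have t: "0 < t" "t < pi" using u by (auto simp: t_def field_simps)
  have st: "sin t > 0" using t by (rule sin_gt_zero)
  have z_cis: "z = cis (- (2 * t))" by (simp add: z_def unity_char_def t_def mult.assoc)
  \<comment> \<open>The chord of the unit circle over the angle 2t has length 2 sin t.\<close>
  have "(norm (z - 1))\<^sup>2 = (cos (2 * t) - 1)\<^sup>2 + (sin (2 * t))\<^sup>2"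
    by (simp add: z_cis cmod_power2)
  also have "\<dots> = (2 * sin t)\<^sup>2"
  proof -
    have "(cos (2 * t) - 1)\<^sup>2 + (sin (2 * t))\<^sup>2 = 2 - 2 * cos (2 * t)"
      using sin_cos_squared_add[of "2 * t"] by (simp add: power2_eq_square algebra_simps)
    also have "\<dots> = (2 * sin t)\<^sup>2" by (simp add: cos_double_sin power_mult_distrib)
    finally show ?thesis .
  qed
  finally have norm_z: "norm (z - 1) = 2 * sin t"
    using st by (metis norm_ge_zero power2_eq_imp_eq mult_nonneg_nonneg less_imp_le zero_le_numeral)
  have "norm (\<Sum>j<k. z ^ j) = norm (z ^ k - 1) / (2 * sin t)"
    using geometric_sum[OF z1, of k] by (simp add: norm_divide norm_z)
  also have "norm (z ^ k - 1) \<le> 2"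
    using norm_triangle_ineq4[of "z ^ k" 1] by (simp add: z_def norm_power)
  hence "norm (z ^ k - 1) / (2 * sin t) \<le> 2 / (2 * sin t)"
    using st by (intro divide_right_mono) auto
  also have "\<dots> = 1 / sin t" by simp
  also have "\<dots> \<le> 2 * real p / real u + 2 * real p / real (p - u)"
  proof (cases "t \<le> pi / 2")
    case True
    have "real u / (2 * real p) \<le> t / 4"
    proof -
      have "real u * 2 \<le> real u * pi" using pi_ge_two by (intro mult_left_mono) auto
      thus ?thesis using p by (simp add: t_def field_simps)
    qed
    also have "\<dots> \<le> sin t" using True t by (intro sin_ge_quarter) auto
    finally have "1 / sin t \<le> 2 * real p / real u" using st u by (simp add: field_simps)
    thus ?thesis by (intro add_increasing2) simp
  next
    case False
    have "real (p - u) / (2 * real p) \<le> (pi - t) / 4"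
    proof -
      define r where "r = real (p - u) / real p"
      have "real (p - u) = real p - real u" using u by (simp add: of_nat_diff)
      hence "pi - t = pi * r"
        using p by (simp add: r_def t_def right_diff_distrib diff_divide_distrib)
      moreover have "2 * r \<le> pi * r"
        using pi_ge_two by (intro mult_right_mono) (auto simp: r_def)
      moreover have "real (p - u) / (2 * real p) = 2 * r / 4" by (simp add: r_def)
      ultimately show ?thesis by simp
    qed
    also have "\<dots> \<le> sin (pi - t)" using False t by (intro sin_ge_quarter) auto
    finally have "1 / sin t \<le> 2 * real p / real (p - u)" using st u by (simp add: field_simps)
    thus ?thesis by (intro add_increasing) simp
  qed
  finally show ?thesis by (simp add: z_def)
qed

lemma zinterval_subset: "p > 0 \<Longrightarrow> zinterval p I \<Longrightarrow> I \<subseteq> {..<p}"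
  by (auto simp: zinterval_def nat_less_iff)

text \<open>A longer interval wraps around and covers every residue, as length p already does. With
  k \<le> p the projection is injective, which permits summing over consecutive integers.\<close>

lemma zinterval_short:
  assumes p: "p > 0" and I: "zinterval p I"
  obtains m k where "I = (\<lambda>x. nat (x mod int p)) ` {m..<m + int k}" "k \<le> p"
proof -
  from I obtain m k where mk: "I = (\<lambda>x. nat (x mod int p)) ` {m..<m + int k}"
    unfolding zinterval_def by blast
  show thesis
  proof (cases "k \<le> p")
    case False
    have "(\<lambda>x. nat (x mod int p)) ` {m..<m + int k} \<subseteq> (\<lambda>x. nat (x mod int p)) ` {m..<m + int p}"
    proof (rule image_subsetI)
      fix x
      have "(m + (x - m) mod int p) mod int p = x mod int p" by (simp add: mod_simps)
      moreover have "m + (x - m) mod int p \<in> {m..<m + int p}" using p by simp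
      ultimately show "nat (x mod int p) \<in> (\<lambda>x. nat (x mod int p)) ` {m..<m + int p}"
        by (intro image_eqI[of _ _ "m + (x - m) mod int p"]) simp_all
    qed
    moreover have "(\<lambda>x. nat (x mod int p)) ` {m..<m + int p} \<subseteq> (\<lambda>x. nat (x mod int p)) ` {m..<m + int k}"
      using False by (intro image_mono) auto
    ultimately show thesis using that[of m p] mk by blast
  qed (use that mk in blast)
qed

lemma norm_fourier_zinterval_le:
  assumes I: "zinterval p I" and u: "u \<in> {1..<p}"
  shows "norm (\<Sum>x\<in>I. unity_char p (- int u * int x)) \<le> 2 * real p / real u + 2 * real p / real (p - u)"
proof -
  have p: "p > 0" using u by simp
  obtain m k where mk: "I = (\<lambda>x. nat (x mod int p)) ` {m..<m + int k}" "k \<le> p"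
    using zinterval_short[OF p I] .
  have inj: "inj_on (\<lambda>x. nat (x mod int p)) {m..<m + int k}"
  proof (rule inj_onI)
    fix x y assume xy: "x \<in> {m..<m + int k}" "y \<in> {m..<m + int k}" "nat (x mod int p) = nat (y mod int p)"
    have "x mod int p = y mod int p" using xy(3) p by (simp add: nat_eq_iff)
    hence "int p dvd x - y" by (simp add: mod_eq_dvd_iff)
    moreover have "\<bar>x - y\<bar> < int p" using xy mk(2) by auto
    ultimately show "x = y" using dvd_imp_le_int[of "x - y" "int p"] by auto
  qed
  have "(\<Sum>x\<in>I. unity_char p (- int u * int x)) = (\<Sum>x\<in>{m..<m + int k}. unity_char p (- int u * x))"
    unfolding mk(1) sum.reindex[OF inj] o_def
    by (intro sum.cong refl unity_char_cong[OF p] cong_mult) (use p in \<open>simp_all add: unique_euclidean_semiring_class.cong_def\<close>)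
  also have "\<dots> = (\<Sum>j<k. unity_char p (- int u * (m + int j)))"
    by (rule sum.reindex_bij_witness[of _ "\<lambda>j. m + int j" "\<lambda>x. nat (x - m)"]) auto
  also have "\<dots> = unity_char p (- int u * m) * (\<Sum>j<k. unity_char p (- int u) ^ j)"
    by (simp add: sum_distrib_left unity_char_power unity_char_add[symmetric] algebra_simps)
  finally show ?thesis using norm_geometric_unity_char_le[OF u] by (simp add: norm_mult)
qed

text \<open>Reflecting u to p - u makes the two halves equal and leaves 4 p times a harmonic number,
  itself at most 1 + ln p. As ln 2 \<ge> 2/3, the 1 is at most 3/2 ln p, whence 10 = 4 *
  5/2.\<close>

lemma sum_norm_fourier_zinterval_le:
  assumes I: "zinterval p I" and p: "p \<ge> 2"
  shows "(\<Sum>u=1..<p. norm (\<Sum>x\<in>I. unity_char p (- int u * int x))) \<le> 10 * real p * ln (real p)"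
proof -
  have "(\<Sum>u=1..<p. norm (\<Sum>x\<in>I. unity_char p (- int u * int x))) \<le>
      (\<Sum>u=1..<p. 2 * real p / real u + 2 * real p / real (p - u))"
    by (intro sum_mono norm_fourier_zinterval_le I)
  also have "\<dots> = (\<Sum>u=1..<p. 2 * real p / real u) + (\<Sum>u=1..<p. 2 * real p / real (p - u))"
    by (rule sum.distrib)
  also have "(\<Sum>u=1..<p. 2 * real p / real (p - u)) = (\<Sum>u=1..<p. 2 * real p / real u)"
    by (rule sum.reindex_bij_witness[of _ "\<lambda>u. p - u" "\<lambda>u. p - u"]) auto
  also have "(\<Sum>u=1..<p. 2 * real p / real u) + (\<Sum>u=1..<p. 2 * real p / real u) = 4 * real p * harm (p - 1)"
  proof -
    have "{1..<p} = {1..p - 1}" using p by auto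
    thus ?thesis by (simp add: harm_def sum_distrib_left divide_inverse mult.assoc)
  qed
  also have "harm (p - 1) \<le> 1 + ln (real p)"
  proof -
    have "harm (p - 1) - ln (real (p - 1)) \<le> harm 1 - ln (real 1)"
      using p by (intro euler_mascheroni_sequence_decreasing) auto
    moreover have "ln (real (p - 1)) \<le> ln (real p)" using p by simp
    ultimately show ?thesis by (simp add: harm_expand)
  qed
  hence "4 * real p * harm (p - 1) \<le> 4 * real p * (1 + ln (real p))"
    by (intro mult_left_mono) auto
  also have "\<dots> \<le> 4 * real p * (5 / 2 * ln (real p))"
  proof -
    have "ln 2 \<le> ln (real p)" using p by simp
    hence "1 \<le> 3 / 2 * ln (real p)" using ln2_ge_two_thirds by linarith
    thus ?thesis by (intro mult_left_mono) auto
  qed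
  finally show ?thesis by simp
qed

lemma zinv_prime:
  assumes "prime p" "s \<in> {1..<p}"
  shows "zinv p s < p" "[s * zinv p s = 1] (mod p)"
proof -
  have "\<not> p dvd s" using assms(2) by (auto dest: dvd_imp_le)
  hence "coprime s p" using prime_imp_coprime[OF assms(1)] by (metis coprime_commute)
  then obtain t where "[s * t = 1] (mod p)" using cong_solve_coprime_nat by auto
  hence t: "t mod p < p \<and> (s * (t mod p)) mod p = 1"
    using prime_gt_1_nat[OF assms(1)] by (auto simp: unique_euclidean_semiring_class.cong_def mod_mult_right_eq)
  have uniq: "t1 = t2" if "t1 < p \<and> (s * t1) mod p = 1" "t2 < p \<and> (s * t2) mod p = 1" for t1 t2
  proof -
    have "[s * t1 = s * t2] (mod p)" using that by (simp add: unique_euclidean_semiring_class.cong_def)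
    hence "[t1 = t2] (mod p)" using \<open>coprime s p\<close> by (simp add: cong_mult_lcancel_nat)
    thus ?thesis using that by (simp add: unique_euclidean_semiring_class.cong_def)
  qed
  have "zinv p s < p \<and> (s * zinv p s) mod p = 1"
    unfolding zinv_def by (rule theI') (use t uniq in blast)
  thus "zinv p s < p" "[s * zinv p s = 1] (mod p)"
    using prime_gt_1_nat[OF assms(1)] by (auto simp: unique_euclidean_semiring_class.cong_def)
qed

section \<open>The discrepancy of the inversion map\<close>

lemma lam_cong: "s \<noteq> 0 \<Longrightarrow> [lam p a s = a * zinv p s] (mod p)"
  by (simp add: lam_def unique_euclidean_semiring_class.cong_def)

text \<open>For s nonzero, \<open>lam p a s * s\<close> is congruent to a, so the value is nonzero
  and determines s.\<close>

lemma bij_betw_lam: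
  assumes p: "prime p" and a: "0 < a" "a < p"
  shows "bij_betw (lam p a) {..<p} {..<p}"
proof -
  have p0: "p > 0" using p by (rule prime_gt_0_nat)
  have cop: "coprime a p"
    using a p by (metis coprime_commute nat_dvd_not_less prime_imp_coprime)
  have inv_a: "[lam p a s * s = a] (mod p)" if "s \<in> {1..<p}" for s
  proof -
    have "[lam p a s * s = a * zinv p s * s] (mod p)"
      using that by (intro cong_mult lam_cong) auto
    also have "a * zinv p s * s = a * (s * zinv p s)" by simp
    also have "[\<dots> = a * 1] (mod p)" by (intro cong_mult zinv_prime p that cong_refl)
    finally show ?thesis by simp
  qed
  have not0: "lam p a s \<noteq> 0" if "s \<in> {1..<p}" for s
  proof
    assume "lam p a s = 0"
    hence "[0 = a] (mod p)" using inv_a[OF that] by simp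
    thus False using a by (auto simp: unique_euclidean_semiring_class.cong_def)
  qed
  have sub: "lam p a ` {..<p} \<subseteq> {..<p}" using p0 by (auto simp: lam_def)
  have "inj_on (lam p a) {..<p}"
  proof (rule inj_onI)
    fix s t assume st: "s \<in> {..<p}" "t \<in> {..<p}" "lam p a s = lam p a t"
    show "s = t"
    proof (cases "s = 0 \<or> t = 0")
      case True
      have "s \<in> {1..<p} \<Longrightarrow> t = 0 \<Longrightarrow> False" "t \<in> {1..<p} \<Longrightarrow> s = 0 \<Longrightarrow> False"
        using not0[of s] not0[of t] st(3) by (auto simp: lam_def split: if_splits)
      thus ?thesis using True st by (cases s; cases t) auto
    next
      case False
      hence s: "s \<in> {1..<p}" and t: "t \<in> {1..<p}" using st by auto
      have "[lam p a s * s = lam p a s * t] (mod p)"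
        using cong_trans[OF inv_a[OF s] cong_sym[OF inv_a[OF t]]] st(3) by simp
      moreover have "coprime (lam p a s) p"
      proof -
        have "lam p a s < p" using sub st by auto
        thus ?thesis using not0[OF s] p
          by (metis coprime_commute gr0I nat_dvd_not_less prime_imp_coprime)
      qed
      ultimately have "[s = t] (mod p)" by (simp add: cong_mult_lcancel_nat)
      thus ?thesis using st by (simp add: unique_euclidean_semiring_class.cong_def)
    qed
  qed
  thus ?thesis using endo_inj_surj[OF _ sub] by (simp add: bij_betw_def)
qed

text \<open>Substituting \<open>s = r / u\<close> turns \<open>u s + v a / s\<close> into \<open>r + u v a / r\<close>; the additional \<open>1\<close> in the sum comes
  from \<open>s = 0\<close>.\<close>

lemma norm_sum_lam_le:
  assumes p: "prime p" and a: "0 < a" "a < p" and u: "u \<in> {1..<p}" and v: "v \<in> {1..<p}"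
  shows "norm (\<Sum>s<p. unity_char p (int u * int s + int v * int (lam p a s))) \<le> 3 * sqrt (real p)"
proof -
  have p0: "p > 0" using p by (rule prime_gt_0_nat)
  define w where "w = zinv p u"
  have uw: "[u * w = 1] (mod p)" unfolding w_def by (rule zinv_prime[OF p u])
  define c where "c = v * a * u"
  define \<rho> where "\<rho> = (\<lambda>r. (w * r) mod p)"
  \<comment> \<open>Modulo p, \<open>\<rho> r\<close> is r / u and w is 1 / u, so this represents 1
    / r; rewriting v * a / \<rho> r in terms of it leaves the parameter c.\<close>
  define iv where "iv = (\<lambda>r. w * zinv p (\<rho> r))"
  have u\<rho>: "[u * \<rho> r = r] (mod p)" for r
  proof -
    have "[u * \<rho> r = u * (w * r)] (mod p)" by (simp add: \<rho>_def unique_euclidean_semiring_class.cong_def mod_mult_right_eq)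
    also have "u * (w * r) = (u * w) * r" by simp
    also have "[\<dots> = 1 * r] (mod p)" by (intro cong_mult uw cong_refl)
    finally show ?thesis by simp
  qed
  have \<rho>: "\<rho> r \<in> {1..<p}" if "r \<in> {1..<p}" for r
  proof -
    have "\<rho> r \<noteq> 0"
    proof
      assume "\<rho> r = 0"
      hence "[0 = r] (mod p)" using u\<rho>[of r] by simp
      thus False using that by (auto simp: unique_euclidean_semiring_class.cong_def)
    qed
    thus ?thesis using p0 by (simp add: \<rho>_def Suc_leI)
  qed
  have bij: "bij_betw \<rho> {1..<p} {1..<p}"
  proof -
    have "inj_on \<rho> {1..<p}"
    proof (rule inj_onI)
      fix r r' assume r: "r \<in> {1..<p}" "r' \<in> {1..<p}" "\<rho> r = \<rho> r'"
      have "[r = r'] (mod p)" using cong_trans[OF cong_sym[OF u\<rho>[of r]]] u\<rho>[of r'] r(3) by simp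
      thus "r = r'" using r by (simp add: unique_euclidean_semiring_class.cong_def)
    qed
    moreover have "\<rho> ` {1..<p} \<subseteq> {1..<p}" using \<rho> by blast
    ultimately show ?thesis using endo_inj_surj[of "{1..<p}" \<rho>] by (simp add: bij_betw_def)
  qed
  have iv: "[r * iv r = 1] (mod p)" if r: "r \<in> {1..<p}" for r
  proof -
    have "r * iv r = (w * r) * zinv p (\<rho> r)" by (simp add: iv_def)
    also have "[\<dots> = \<rho> r * zinv p (\<rho> r)] (mod p)"
      by (intro cong_mult cong_refl) (simp add: \<rho>_def unique_euclidean_semiring_class.cong_def)
    also have "[\<rho> r * zinv p (\<rho> r) = 1] (mod p)" by (rule zinv_prime[OF p \<rho>[OF r]])
    finally show ?thesis .
  qed
  have "\<not> p dvd c"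
    using u v a p by (auto simp: c_def prime_dvd_mult_iff dest: dvd_imp_le)
  hence weil: "norm (\<Sum>r=1..<p. cis (2 * pi * real (r + c * iv r) / real p)) \<le> 2 * sqrt (real p)"
    using kloosterman_bound[OF p] iv unfolding kloosterman_bound_def by blast
  have term_eq: "unity_char p (int u * int (\<rho> r) + int v * int (lam p a (\<rho> r))) =
      cis (2 * pi * real (r + c * iv r) / real p)" if r: "r \<in> {1..<p}" for r
  proof -
    have "[v * lam p a (\<rho> r) = v * (a * zinv p (\<rho> r))] (mod p)"
      using \<rho>[OF r] by (intro cong_mult cong_refl lam_cong) auto
    also have "[v * (a * zinv p (\<rho> r)) = (u * w) * (v * (a * zinv p (\<rho> r)))] (mod p)"
      using cong_mult[OF cong_sym[OF uw] cong_refl, of "v * (a * zinv p (\<rho> r))"] by simp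
    also have "(u * w) * (v * (a * zinv p (\<rho> r))) = c * iv r" by (simp add: c_def iv_def)
    finally have "[u * \<rho> r + v * lam p a (\<rho> r) = r + c * iv r] (mod p)"
      by (intro cong_add u\<rho>)
    hence "[int (u * \<rho> r + v * lam p a (\<rho> r)) = int (r + c * iv r)] (mod int p)"
      by (simp only: cong_int_iff)
    from unity_char_cong[OF p0 this] show ?thesis by (simp add: unity_char_def)
  qed
  have "(\<Sum>s<p. unity_char p (int u * int s + int v * int (lam p a s))) =
      1 + (\<Sum>s=1..<p. unity_char p (int u * int s + int v * int (lam p a s)))"
    using p0 by (simp add: lessThan_atLeast0 sum.atLeast_Suc_lessThan lam_def)
  also have "(\<Sum>s=1..<p. unity_char p (int u * int s + int v * int (lam p a s))) =
      (\<Sum>r=1..<p. unity_char p (int u * int (\<rho> r) + int v * int (lam p a (\<rho> r))))"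
    by (rule sum.reindex_bij_betw[OF bij, symmetric])
  also have "\<dots> = (\<Sum>r=1..<p. cis (2 * pi * real (r + c * iv r) / real p))"
    by (intro sum.cong refl term_eq)
  finally have "norm (\<Sum>s<p. unity_char p (int u * int s + int v * int (lam p a s))) \<le>
      norm (1 :: complex) + norm (\<Sum>r=1..<p. cis (2 * pi * real (r + c * iv r) / real p))"
    by (simp only: norm_triangle_ineq)
  moreover have "1 \<le> sqrt (real p)" using p0 by simp
  ultimately show ?thesis using weil unfolding norm_one by linarith
qed

text \<open>The constant is 3 from the exponential sum times 10 from each interval; the powers of p
  from the intervals cancel against 1/p^2.\<close>

lemma disc_lam_le:
  assumes p: "prime p" and a: "0 < a" "a < p" and I: "zinterval p I" and J: "zinterval p J"
  shows "disc p (lam p a ` I) J \<le> 300 * sqrt (real p) * (ln (real p))\<^sup>2"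
proof -
  have p2: "p \<ge> 2" using p by (rule prime_ge_2_nat)
  have p0: "p > 0" using p2 by simp
  let ?L = "10 * real p * ln (real p)"
  have "disc p (lam p a ` I) J \<le> 3 * sqrt (real p) / (real p)\<^sup>2 *
           (\<Sum>u=1..<p. norm (\<Sum>x\<in>I. unity_char p (- int u * int x))) *
           (\<Sum>v=1..<p. norm (\<Sum>y\<in>J. unity_char p (- int v * int y)))"
    by (intro disc_le_fourier p0 bij_betw_lam norm_sum_lam_le p a zinterval_subset I J)
  also have "\<dots> \<le> 3 * sqrt (real p) / (real p)\<^sup>2 * ?L * ?L"
    using p2 by (intro mult_mono sum_norm_fourier_zinterval_le I J) (auto intro!: sum_nonneg mult_nonneg_nonneg)
  also have "\<dots> = 300 * sqrt (real p) * (ln (real p))\<^sup>2"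
    using p0 by (simp add: power2_eq_square)
  finally show ?thesis .
qed

theorem mainTheorem7:
  shows "\<exists>C::real. \<forall>(p::nat) (a::nat). prime p \<and> 0 < a \<and> a < p \<longrightarrow>
           Dperm p (lam p a) \<le> C * sqrt (real p) * (ln (real p))^2"
proof (intro exI[of _ 300] allI impI)
  fix p a :: nat assume pa: "prime p \<and> 0 < a \<and> a < p"
  have p0: "p > 0" using pa by (auto intro: prime_gt_0_nat)
  let ?A = "{disc p (lam p a ` I) J | I J. zinterval p I \<and> zinterval p J}"
  have "?A \<subseteq> (\<lambda>(I, J). disc p (lam p a ` I) J) ` (Pow {..<p} \<times> Pow {..<p})"
    using zinterval_subset[OF p0] by fast
  hence "finite ?A" by (rule finite_subset) simp
  moreover have "zinterval p {}" unfolding zinterval_def by (intro exI[of _ 0]) simp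
  hence "?A \<noteq> {}" by blast
  ultimately show "Dperm p (lam p a) \<le> 300 * sqrt (real p) * (ln (real p))^2"
    unfolding Dperm_def using disc_lam_le pa by (subst Max_le_iff) auto
qed

end
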